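(* Let $R=GR(4,n)$, let $f:T\to T$ be a pseudo-planar function with $f(0)=0$, and let $\mathcal{S}_0,\dots,\mathcal{S}_5\subseteq R$ and $\mathcal{E}_0,\dots,\mathcal{E}_5\subseteq\widehat{R}$ be the sets associated with $f$ as defined in the context. Then $(R,\{\mathcal{S}_i\}_{i=0}^5)$ is a Schur ring, whose dual is $(\widehat{R},\{\mathcal{E}_i\}_{i=0}^5)$. If $n\ge 3$, then $(R,\{\mathcal{R}_i\}_{i=0}^5)$, where $\mathcal{R}_i=\{(x,y)\in R\times R\mid x-y\in\mathcal{S}_i\}$, is a $5$-class association scheme, whose first eigenmatrix $P$ (rows indexed by $\mathcal{E}_0,\dots,\mathcal{E}_5$, columns by $\mathcal{S}_0,\dots,\mathcal{S}_5$) and second eigenmatrix $Q$ are as follows, with $\mathbf{i}=\sqrt{-1}$. When $n$ is odd, with $b=2^{(n-1)/2}$, $$P=\begin{bmatrix} 1&2b^2-1&2b^2-1&2b^2-1&2b^4-3b^2+1&2b^4-3b^2+1\\ 1&-1&-1&2b^2-1&-b^2+1&-b^2+1\\ 1&-1+b+b\mathbf{i}&-1+b-b\mathbf{i}&-1&(1-b)(1-b\mathbf{i})&(1-b)(1+b\mathbf{i})\\ 1&-1+b-b\mathbf{i}&-1+b+b\mathbf{i}&-1&(1-b)(1+b\mathbf{i})&(1-b)(1-b\mathbf{i})\\ 1&-1-b+b\mathbf{i}&-1-b-b\mathbf{i}&-1&(1+b)(1-b\mathbf{i})&(1+b)(1+b\mathbf{i})\\ 1&-1-b-b\mathbf{i}&-1-b+b\mathbf{i}&-1&(1+b)(1+b\mathbf{i})&(1+b)(1-b\mathbf{i})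 \end{bmatrix}$$ and $$Q=\begin{bmatrix} 1&2b^2-1&\frac b2(2b^3+2b^2-b-1)&\frac b2(2b^3+2b^2-b-1)&\frac b2(2b^3-2b^2-b+1)&\frac b2(2b^3-2b^2-b+1)\\ 1&-1&\frac b2(b^2-1-(b^2+b)\mathbf{i})&\frac b2(b^2-1+(b^2+b)\mathbf{i})&\frac b2(1-b^2-(b^2-b)\mathbf{i})&\frac b2(1-b^2+(b^2-b)\mathbf{i})\\ 1&-1&\frac b2(b^2-1+(b^2+b)\mathbf{i})&\frac b2(b^2-1-(b^2+b)\mathbf{i})&\frac b2(1-b^2+(b^2-b)\mathbf{i})&\frac b2(1-b^2-(b^2-b)\mathbf{i})\\ 1&2b^2-1&-\frac b2(1+b)&-\frac b2(1+b)&\frac b2(1-b)&\frac b2(1-b)\\ 1&-1&-\frac b2(1+b\mathbf{i})&\frac b2(-1+b\mathbf{i})&\frac b2(1+b\mathbf{i})&\frac b2(1-b\mathbf{i})\\ 1&-1&\frac b2(-1+b\mathbf{i})&-\frac b2(1+b\mathbf{i})&\frac b2(1-b\mathbf{i})&\frac{b(b^2+1)}{2(1-b\mathbf{i})} \end{bmatrix}.$$ When $n$ is even, with $b=2^{(n-2)/2}$, $$P=\begin{bmatrix} 1&4b^2-1&4b^2-1&4b^2-1&8b^4-10b^2+2&8b^4-2b^2\\ 1&-1&-1&4b^2-1&-2b^2+2&-2b^2\\ 1&2b-1&2b-1&-1&2b^2-4b+2&-2b^2\\ 1&-2b-1&-2b-1&-1&2b^2+4b+2&-2b^2\\ 1&-1+2b\mathbf{i}&-1-2b\mathbf{i}&-1&-2b^2+2&2b^2\\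 1&-1-2b\mathbf{i}&-1+2b\mathbf{i}&-1&-2b^2+2&2b^2 \end{bmatrix}$$ and $$Q=\begin{bmatrix} 1&4b^2-1&b(4b^3+4b^2-b-1)&b(4b^3-4b^2-b+1)&b^2(4b^2-1)&b^2(4b^2-1)\\ 1&-1&b(2b^2+b-1)&-(2b^2-b-1)b&-b^2(1+2b\mathbf{i})&b^2(-1+2b\mathbf{i})\\ 1&-1&b(2b^2+b-1)&-(2b^2-b-1)b&b^2(-1+2b\mathbf{i})&-b^2(1+2b\mathbf{i})\\ 1&4b^2-1&-b(1+b)&-b(-1+b)&-b^2&-b^2\\ 1&-1&b(-1+b)&b(1+b)&-b^2&-b^2\\ 1&-1&-b(1+b)&-b(-1+b)&b^2&b^2 \end{bmatrix}.$$
   Context: $R=GR(4,n)$ is the Galois ring of characteristic $4$ with $4^n$ elements, and $Z=\{2x\mid x\in R\}$. The unit group $R\setminus Z$ contains a cyclic subgroup of order $2^n-1$ generated by some $\xi$; $T=\{\xi^i\mid 0\le i\le 2^n-2\}\cup\{0\}$ is the Teichmüller system. Each $x\in R$ is uniquely $x=a+2b$ with $a,b\in T$. Write $\sqrt{x}=x^{2^{n-1}}$ for $x\in R$. With $x\oplus y=x+y+2\sqrt{xy}$, $(T,\oplus,\cdot)$ is a field with $2^n$ elements, identified with $\mathbb{F}_{2^n}$. A function $f:T\to T$ is pseudo-planar if for each $\epsilon\in T\setminus\{0\}$ the map $x\mapsto f(x\oplus\epsilon)\oplus f(x)\oplus \epsilon x$ is a permutation of $T$. Trace: $\mathrm{Tr}:R\to\mathbb{Z}_4$,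 $\mathrm{Tr}(x)=\sum_{i=0}^{n-1}\sigma^i(x)$, where $\sigma(a+2b)=a^2+2b^2$ for $a,b\in T$. The characters of $(R,+)$ are $\chi_a(x)=\mathbf{i}^{\mathrm{Tr}(ax)}$, $a\in R$, and $\widehat{R}=\{\chi_a\mid a\in R\}$. For a subset (or multiset) $A$ of $R$, $\chi(A)=\sum_{g\in A}\chi(g)$ (with multiplicity). Sets attached to $f$: $D_f=\{x+2\sqrt{f(x)}\mid x\in T\}$; $\mathcal{S}_0=\{0\}$; $\mathcal{S}_1=D_f\setminus\{0\}$; $\mathcal{S}_2=\{-x\mid x\in\mathcal{S}_1\}$; $\mathcal{S}_3=Z\setminus\{0\}$; $\mathcal{S}_4$ is the set of elements of $R\setminus(\mathcal{S}_0\cup\mathcal{S}_1\cup\mathcal{S}_2\cup\mathcal{S}_3)$ of the form $d+d'$ with $d,d'\in D_f$; $\mathcal{S}_5$ is the set of all remaining elements of $R$. Partition of $\widehat{R}$: $\mathcal{E}_0=\{\chi_0\}$, $\mathcal{E}_1=\{\chi\mid\chi(\mathcal{S}_1)=-1\}=\{\chi_a\mid a\in Z\setminus\{0\}\}$, and $\mathcal{E}_j=\{\chi\in\widehat{R}\mid\chi(\mathcal{S}_1)=-1+v_j\}$ for $j=2,3,4,5$, where: if $n$ is odd, with $c=2^{(n-1)/2}$, $v_2=c+c\mathbf{i}$, $v_3=c-c\mathbf{i}$, $v_4=-c+c\mathbf{i}$, $v_5=-c-c\mathbf{i}$; if $n$ is even, $v_2=2^{n/2}$, $v_3=-2^{n/2}$,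 $v_4=2^{n/2}\mathbf{i}$, $v_5=-2^{n/2}\mathbf{i}$. Association schemes: Let $X$ be a finite nonempty set and $R_0,\dots,R_d$ a partition of $X\times X$ with $R_0$ the diagonal and such that the transpose of each $R_i$ is some $R_{i'}$. With $A_i$ the adjacency matrix of $R_i$, it is a $d$-class association scheme if $A_iA_j=\sum_k p_{i,j}^kA_k$ for some nonnegative integers $p_{i,j}^k$ (the schemes here are commutative). The span of the $A_i$ has a basis of pairwise orthogonal idempotents $E_0,\dots,E_d$; the first and second eigenmatrices $P=(P_{ji})$, $Q=(Q_{ji})$ (row $j$, column $i$) are defined by $A_i=\sum_jP_{ji}E_j$ and $E_i=\frac1{|X|}\sum_jQ_{ji}A_j$, so $PQ=|X|I$. Here the idempotents are ordered so that $P_{ji}=\chi(\mathcal{S}_i)$ for $\chi\in\mathcal{E}_j$. For a finite abelian group $X$ with partition $\{S_i\}_{i=0}^d$, $(X,\{S_i\})$ is a Schur ring if the relations $\{(x,y)\mid x-y\in S_i\}$ form an association scheme on $X$. Its dual is $(\widehat{X},\{T_i\})$, where the $T_i$ are the classes of the equivalence relation on $\widehat{X}$: $\chi\sim\chi'$ iff $\chi(S_i)=\chi'(S_i)$ for all $i$, with $T_0$ consisting of the principal character. For $n=1,2$ some of the sets $\mathcal{S}_i,\mathcal{E}_i$ are empty; empty classes are discarded. *)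

theory Defs
  imports "HOL-Analysis.Analysis"
begin

section \<open>Association schemes\<close>

definition adjacency_matrix :: "('x::finite \<times> 'x) set \<Rightarrow> complex^'x^'x" where
  "adjacency_matrix r = (\<chi> x y. if (x, y) \<in> r then 1 else 0)"

text \<open>The library has no multiplication of a matrix by a complex scalar
  (\<open>*\<^sub>R\<close> is over the reals, \<open>*s\<close> acts on vectors).\<close>

definition scale_mat :: "complex \<Rightarrow> complex^'n^'m \<Rightarrow> complex^'n^'m" (infixr \<open>*\<^sub>M\<close> 75) where
  "c *\<^sub>M M = (\<chi> x y. c * M $ x $ y)"

text \<open>The point set is the (finite, nonempty) type \<open>'x\<close>. The relations are indexed by a finite
  set \<open>I\<close> of natural numbers containing \<open>0\<close>, and the number of classes is \<open>card I - 1\<close>.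
  Allowing \<open>I\<close> to have gaps makes it possible to discard empty classes without renumbering.
  Schemes are commutative by convention.\<close>

definition association_scheme :: "nat set \<Rightarrow> (nat \<Rightarrow> ('x::finite \<times> 'x) set) \<Rightarrow> bool" where
  "association_scheme I r \<longleftrightarrow>
     finite I \<and> 0 \<in> I \<and>
     inj_on r I \<and> partition_on UNIV (r ` I) \<and>
     r 0 = Id \<and>
     (\<forall>i\<in>I. \<exists>i'\<in>I. (r i)\<inverse> = r i') \<and>
     (\<forall>i\<in>I. \<forall>j\<in>I. \<exists>p :: nat \<Rightarrow> nat.
        adjacency_matrix (r i) ** adjacency_matrix (r j) =
          (\<Sum>k\<in>I. of_nat (p k) *\<^sub>M adjacency_matrix (r k))) \<and>
     (\<forall>i\<in>I. \<forall>j\<in>I.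
        adjacency_matrix (r i) ** adjacency_matrix (r j) =
        adjacency_matrix (r j) ** adjacency_matrix (r i))"

definition orthogonal_idempotent_basis ::
    "nat set \<Rightarrow> (nat \<Rightarrow> ('x::finite \<times> 'x) set) \<Rightarrow> (nat \<Rightarrow> complex^'x^'x) \<Rightarrow> bool" where
  "orthogonal_idempotent_basis I r E \<longleftrightarrow>
     inj_on E I \<and>
     \<not> module.dependent (*\<^sub>M) (E ` I) \<and>
     module.span (*\<^sub>M) (E ` I) = module.span (*\<^sub>M) ((\<lambda>i. adjacency_matrix (r i)) ` I) \<and>
     (\<forall>i\<in>I. E i ** E i = E i) \<and>
     (\<forall>i\<in>I. \<forall>j\<in>I. i \<noteq> j \<longrightarrow> E i ** E j = 0)"

text \<open>\<open>P j i\<close> and \<open>Q j i\<close> are the entries in row \<open>j\<close> and column \<open>i\<close>.\<close>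

definition first_eigenmatrix ::
    "nat set \<Rightarrow> (nat \<Rightarrow> ('x::finite \<times> 'x) set) \<Rightarrow> (nat \<Rightarrow> complex^'x^'x) \<Rightarrow>
     (nat \<Rightarrow> nat \<Rightarrow> complex) \<Rightarrow> bool" where
  "first_eigenmatrix I r E P \<longleftrightarrow>
     (\<forall>i\<in>I. adjacency_matrix (r i) = (\<Sum>j\<in>I. P j i *\<^sub>M E j))"

definition second_eigenmatrix ::
    "nat set \<Rightarrow> (nat \<Rightarrow> ('x::finite \<times> 'x) set) \<Rightarrow> (nat \<Rightarrow> complex^'x^'x) \<Rightarrow>
     (nat \<Rightarrow> nat \<Rightarrow> complex) \<Rightarrow> bool" where
  "second_eigenmatrix I r E Q \<longleftrightarrow>
     (\<forall>i\<in>I. E i = (1 / of_nat CARD('x)) *\<^sub>M (\<Sum>j\<in>I. Q j i *\<^sub>M adjacency_matrix (r j)))"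


section \<open>Schur rings and their duals\<close>

definition cayley_relation :: "'a::ab_group_add set \<Rightarrow> ('a \<times> 'a) set" where
  "cayley_relation A = {(x, y). x - y \<in> A}"

definition schur_ring :: "nat set \<Rightarrow> (nat \<Rightarrow> 'a::{finite,ab_group_add} set) \<Rightarrow> bool" where
  "schur_ring I S \<longleftrightarrow>
     inj_on S I \<and> partition_on UNIV (S ` I) \<and>
     association_scheme I (\<lambda>i. cayley_relation (S i))"

definition char_group :: "('a::{finite,ab_group_add} \<Rightarrow> complex) set" where
  "char_group = {\<psi>. \<psi> 0 = 1 \<and> (\<forall>x y. \<psi> (x + y) = \<psi> x * \<psi> y)}"

definition char_sum :: "('a \<Rightarrow> complex) \<Rightarrow> 'a set \<Rightarrow> complex" where
  "char_sum \<psi> A = (\<Sum>g\<in>A. \<psi> g)"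

definition dual_equiv ::
    "nat set \<Rightarrow> (nat \<Rightarrow> 'a::{finite,ab_group_add} set) \<Rightarrow>
     (('a \<Rightarrow> complex) \<times> ('a \<Rightarrow> complex)) set" where
  "dual_equiv I S = {(\<psi>, \<psi>'). \<psi> \<in> char_group \<and> \<psi>' \<in> char_group \<and>
                       (\<forall>i\<in>I. char_sum \<psi> (S i) = char_sum \<psi>' (S i))}"

definition schur_dual ::
    "nat set \<Rightarrow> (nat \<Rightarrow> 'a::{finite,ab_group_add} set) \<Rightarrow>
     nat set \<Rightarrow> (nat \<Rightarrow> ('a \<Rightarrow> complex) set) \<Rightarrow> bool" where
  "schur_dual I S J T \<longleftrightarrow>
     0 \<in> J \<and> T 0 = {\<lambda>_. 1} \<and>
     bij_betw T J (char_group // dual_equiv I S)"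


section \<open>The Galois ring of characteristic 4 and its Teichmueller system\<close>

text \<open>A Galois ring is a finite commutative ring whose zero divisors, together with \<open>0\<close>, form the
  principal ideal generated by a prime \<open>p\<close>. With characteristic \<open>4\<close> (so \<open>p = 2\<close>) and
  cardinality \<open>4 ^ n\<close> this determines \<open>GR(4,n)\<close> up to isomorphism; the case \<open>n = 0\<close> is excluded
  by \<open>0 \<noteq> 1\<close>.\<close>

definition galois_ring_4 :: "'r::{finite,comm_ring_1} itself \<Rightarrow> nat \<Rightarrow> bool" where
  "galois_ring_4 _ n \<longleftrightarrow>
     CHAR('r) = 4 \<and> CARD('r) = 4 ^ n \<and>
     {x::'r. \<exists>y. y \<noteq> 0 \<and> x * y = 0} = range (\<lambda>x. 2 * x)"

text \<open>\<open>\<xi>\<close> has multiplicative order exactly \<open>2 ^ n - 1\<close>.\<close>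

definition teich_generator :: "nat \<Rightarrow> 'r::comm_ring_1 \<Rightarrow> bool" where
  "teich_generator n \<xi> \<longleftrightarrow>
     \<xi> ^ (2 ^ n - 1) = 1 \<and> (\<forall>k. 0 < k \<and> k < 2 ^ n - 1 \<longrightarrow> \<xi> ^ k \<noteq> 1)"

definition teich :: "nat \<Rightarrow> 'r::comm_ring_1 \<Rightarrow> 'r set" where
  "teich n \<xi> = {\<xi> ^ i | i. i \<le> 2 ^ n - 2} \<union> {0}"

definition gr_sqrt :: "nat \<Rightarrow> 'r::comm_ring_1 \<Rightarrow> 'r" where
  "gr_sqrt n x = x ^ (2 ^ (n - 1))"

definition oplus :: "nat \<Rightarrow> 'r::comm_ring_1 \<Rightarrow> 'r \<Rightarrow> 'r" where
  "oplus n x y = x + y + 2 * gr_sqrt n (x * y)"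

text \<open>Only the values of \<open>f\<close> on the Teichmueller system are relevant.\<close>

definition pseudo_planar :: "nat \<Rightarrow> 'r::comm_ring_1 \<Rightarrow> ('r \<Rightarrow> 'r) \<Rightarrow> bool" where
  "pseudo_planar n \<xi> f \<longleftrightarrow>
     f ` teich n \<xi> \<subseteq> teich n \<xi> \<and>
     (\<forall>\<epsilon> \<in> teich n \<xi> - {0}.
        bij_betw (\<lambda>x. oplus n (oplus n (f (oplus n x \<epsilon>)) (f x)) (\<epsilon> * x)) (teich n \<xi>) (teich n \<xi>))"

definition frob :: "nat \<Rightarrow> 'r::comm_ring_1 \<Rightarrow> 'r \<Rightarrow> 'r" where
  "frob n \<xi> x = (THE y. \<exists>a\<in>teich n \<xi>. \<exists>b\<in>teich n \<xi>. x = a + 2 * b \<and> y = a ^ 2 + 2 * b ^ 2)"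

text \<open>The trace takes values in the subring \<open>{0, 1, 2, 3}\<close> of the Galois ring, a copy of
  the integers modulo \<open>4\<close>; the character converts such a value to an exponent.\<close>

definition gr_trace :: "nat \<Rightarrow> 'r::comm_ring_1 \<Rightarrow> 'r \<Rightarrow> 'r" where
  "gr_trace n \<xi> x = (\<Sum>i<n. (frob n \<xi> ^^ i) x)"

definition gr_char :: "nat \<Rightarrow> 'r::comm_ring_1 \<Rightarrow> 'r \<Rightarrow> 'r \<Rightarrow> complex" where
  "gr_char n \<xi> a x = \<i> ^ (THE k::nat. k < 4 \<and> of_nat k = gr_trace n \<xi> (a * x))"

definition gr_chars :: "nat \<Rightarrow> 'r::comm_ring_1 \<Rightarrow> ('r \<Rightarrow> complex) set" where
  "gr_chars n \<xi> = range (gr_char n \<xi>)"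


section \<open>The partitions attached to a pseudo-planar function\<close>

definition D_set :: "nat \<Rightarrow> 'r::comm_ring_1 \<Rightarrow> ('r \<Rightarrow> 'r) \<Rightarrow> 'r set" where
  "D_set n \<xi> f = {x + 2 * gr_sqrt n (f x) | x. x \<in> teich n \<xi>}"

definition S_class :: "nat \<Rightarrow> 'r::comm_ring_1 \<Rightarrow> ('r \<Rightarrow> 'r) \<Rightarrow> nat \<Rightarrow> 'r set" where
  "S_class n \<xi> f i =
    (let D  = D_set n \<xi> f;
         S0 = {0};
         S1 = D - {0};
         S2 = {- x | x. x \<in> S1};
         S3 = range (\<lambda>x. 2 * x) - {0};
         S4 = {d + d' | d d'. d \<in> D \<and> d' \<in> D} - (S0 \<union> S1 \<union> S2 \<union> S3);
         S5 = UNIV - (S0 \<union> S1 \<union> S2 \<union> S3 \<union> S4)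
     in [S0, S1, S2, S3, S4, S5] ! i)"

definition v_value :: "nat \<Rightarrow> nat \<Rightarrow> complex" where
  "v_value n j =
    (if odd n then
       (let c = 2 ^ ((n - 1) div 2)
        in [c + c * \<i>, c - c * \<i>, - c + c * \<i>, - c - c * \<i>] ! (j - 2))
     else
       (let c = 2 ^ (n div 2)
        in [c, - c, c * \<i>, - c * \<i>] ! (j - 2)))"

definition E_class :: "nat \<Rightarrow> 'r::comm_ring_1 \<Rightarrow> ('r \<Rightarrow> 'r) \<Rightarrow> nat \<Rightarrow> ('r \<Rightarrow> complex) set" where
  "E_class n \<xi> f j =
    (if j = 0 then {gr_char n \<xi> 0}
     else if j = 1 then {\<psi> \<in> gr_chars n \<xi>. char_sum \<psi> (S_class n \<xi> f 1) = - 1}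
     else {\<psi> \<in> gr_chars n \<xi>. char_sum \<psi> (S_class n \<xi> f 1) = - 1 + v_value n j})"

definition nonempty_classes :: "(nat \<Rightarrow> 'b set) \<Rightarrow> nat set" where
  "nonempty_classes C = {i \<in> {0..5}. C i \<noteq> {}}"


section \<open>The eigenmatrices\<close>

definition P_odd :: "complex \<Rightarrow> nat \<Rightarrow> nat \<Rightarrow> complex" where
  "P_odd b j i =
   [[1, 2*b^2 - 1, 2*b^2 - 1, 2*b^2 - 1, 2*b^4 - 3*b^2 + 1, 2*b^4 - 3*b^2 + 1],
    [1, -1, -1, 2*b^2 - 1, - (b^2) + 1, - (b^2) + 1],
    [1, -1 + b + b*\<i>, -1 + b - b*\<i>, -1, (1 - b) * (1 - b*\<i>), (1 - b) * (1 + b*\<i>)],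
    [1, -1 + b - b*\<i>, -1 + b + b*\<i>, -1, (1 - b) * (1 + b*\<i>), (1 - b) * (1 - b*\<i>)],
    [1, -1 - b + b*\<i>, -1 - b - b*\<i>, -1, (1 + b) * (1 - b*\<i>), (1 + b) * (1 + b*\<i>)],
    [1, -1 - b - b*\<i>, -1 - b + b*\<i>, -1, (1 + b) * (1 + b*\<i>), (1 + b) * (1 - b*\<i>)]] ! j ! i"

definition Q_odd :: "complex \<Rightarrow> nat \<Rightarrow> nat \<Rightarrow> complex" where
  "Q_odd b j i =
   [[1, 2*b^2 - 1,
       b/2 * (2*b^3 + 2*b^2 - b - 1), b/2 * (2*b^3 + 2*b^2 - b - 1),
       b/2 * (2*b^3 - 2*b^2 - b + 1), b/2 * (2*b^3 - 2*b^2 - b + 1)],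
    [1, -1,
       b/2 * (b^2 - 1 - (b^2 + b)*\<i>), b/2 * (b^2 - 1 + (b^2 + b)*\<i>),
       b/2 * (1 - b^2 - (b^2 - b)*\<i>), b/2 * (1 - b^2 + (b^2 - b)*\<i>)],
    [1, -1,
       b/2 * (b^2 - 1 + (b^2 + b)*\<i>), b/2 * (b^2 - 1 - (b^2 + b)*\<i>),
       b/2 * (1 - b^2 + (b^2 - b)*\<i>), b/2 * (1 - b^2 - (b^2 - b)*\<i>)],
    [1, 2*b^2 - 1,
       - (b/2) * (1 + b), - (b/2) * (1 + b), b/2 * (1 - b), b/2 * (1 - b)],
    [1, -1,
       - (b/2) * (1 + b*\<i>), b/2 * (-1 + b*\<i>), b/2 * (1 + b*\<i>), b/2 * (1 - b*\<i>)],
    [1, -1,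
       b/2 * (-1 + b*\<i>), - (b/2) * (1 + b*\<i>), b/2 * (1 - b*\<i>),
       (b * (b^2 + 1)) / (2 * (1 - b*\<i>))]] ! j ! i"

definition P_even :: "complex \<Rightarrow> nat \<Rightarrow> nat \<Rightarrow> complex" where
  "P_even b j i =
   [[1, 4*b^2 - 1, 4*b^2 - 1, 4*b^2 - 1, 8*b^4 - 10*b^2 + 2, 8*b^4 - 2*b^2],
    [1, -1, -1, 4*b^2 - 1, - 2*b^2 + 2, - 2*b^2],
    [1, 2*b - 1, 2*b - 1, -1, 2*b^2 - 4*b + 2, - 2*b^2],
    [1, - 2*b - 1, - 2*b - 1, -1, 2*b^2 + 4*b + 2, - 2*b^2],
    [1, -1 + 2*b*\<i>, -1 - 2*b*\<i>, -1, - 2*b^2 + 2, 2*b^2],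
    [1, -1 - 2*b*\<i>, -1 + 2*b*\<i>, -1, - 2*b^2 + 2, 2*b^2]] ! j ! i"

definition Q_even :: "complex \<Rightarrow> nat \<Rightarrow> nat \<Rightarrow> complex" where
  "Q_even b j i =
   [[1, 4*b^2 - 1,
       b * (4*b^3 + 4*b^2 - b - 1), b * (4*b^3 - 4*b^2 - b + 1),
       b^2 * (4*b^2 - 1), b^2 * (4*b^2 - 1)],
    [1, -1,
       b * (2*b^2 + b - 1), - (2*b^2 - b - 1) * b,
       - (b^2) * (1 + 2*b*\<i>), b^2 * (-1 + 2*b*\<i>)],
    [1, -1,
       b * (2*b^2 + b - 1), - (2*b^2 - b - 1) * b,
       b^2 * (-1 + 2*b*\<i>), - (b^2) * (1 + 2*b*\<i>)],
    [1, 4*b^2 - 1, - b * (1 + b), - b * (-1 + b), - (b^2), - (b^2)],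
    [1, -1, b * (-1 + b), b * (1 + b), - (b^2), - (b^2)],
    [1, -1, - b * (1 + b), - b * (-1 + b), b^2, b^2]] ! j ! i"

definition P_matrix :: "nat \<Rightarrow> nat \<Rightarrow> nat \<Rightarrow> complex" where
  "P_matrix n = (if odd n then P_odd (2 ^ ((n - 1) div 2)) else P_even (2 ^ ((n - 2) div 2)))"

definition Q_matrix :: "nat \<Rightarrow> nat \<Rightarrow> nat \<Rightarrow> complex" where
  "Q_matrix n = (if odd n then Q_odd (2 ^ ((n - 1) div 2)) else Q_even (2 ^ ((n - 2) div 2)))"

end

theory Submission
  imports Defs
begin

text \<open>
  \<open>D = D_f\<close> is a transversal of \<open>Z\<close> in \<open>R\<close>, and pseudo-planarity says that every element outside
  \<open>Z\<close> is a difference \<open>d - d'\<close> in exactly one way. Hence for a character \<open>\<chi>\<close> nontrivial on \<open>Z\<close>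
  the Gaussian integer \<open>\<chi>(D)\<close> has norm \<open>2^n\<close>, which leaves four values; the other nonprincipal characters
  vanish on \<open>D\<close>. Unique differences also give \<open>D \<cdot> D = Z + 2Y\<close> in the group ring, where \<open>Y\<close> is the set of
  sums \<open>d + d'\<close> with \<open>d \<noteq> d'\<close>. Since \<open>\<chi>(D)^2\<close> is real for even \<open>n\<close> and purely imaginary or zero for odd
  \<open>n\<close> and nonprincipal \<open>\<chi>\<close>, Fourier inversion yields \<open>-Y = Y\<close> respectively that \<open>Z\<close>, \<open>Y\<close>, \<open>-Y\<close> partition \<open>R\<close>.
  So \<open>\<chi>(D)\<close> determines all \<open>\<chi>(S_i)\<close>, which gives \<open>P\<close>. As \<open>P Q = |R| I\<close>, the indicators of the \<open>S_i\<close>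
  and the idempotents attached to the \<open>E_j\<close> are combinations of each other (also when some of them
  vanish), so the span of the former is closed under convolution.
\<close>

section \<open>Fourier analysis for a self-dual pairing\<close>

text \<open>A symmetric nondegenerate pairing names characters by group elements; by symmetry one
  orthogonality relation serves both for sums over elements and for sums over characters.\<close>

locale self_dual_pairing =
  fixes \<omega> :: "'g::{finite,ab_group_add} \<Rightarrow> 'g \<Rightarrow> complex"
  assumes pairing_add: "\<omega> a (x + y) = \<omega> a x * \<omega> a y"
    and pairing_commute: "\<omega> a x = \<omega> x a"
    and pairing_zero: "\<omega> a 0 = 1"
    and pairing_nontrivial: "a \<noteq> 0 \<Longrightarrow> \<exists>x. \<omega> a x \<noteq> 1"

text \<open>Translation by \<open>t\<close> permutes the group and multiplies the sum by
  \<open>\<psi> t\<close>, which is not 1.\<close>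

lemma char_group_sum_eq_0:
  fixes \<psi> :: "'g::{finite,ab_group_add} \<Rightarrow> complex"
  assumes "\<psi> \<in> char_group" "\<psi> t \<noteq> 1"
  shows "(\<Sum>x\<in>UNIV. \<psi> x) = 0"
proof -
  have "(\<Sum>x\<in>UNIV. \<psi> x) = (\<Sum>x\<in>UNIV. \<psi> (t + x))"
    by (rule sum.reindex_bij_witness[of _ "\<lambda>x. t + x" "\<lambda>x. x - t"]) auto
  also have "\<dots> = \<psi> t * (\<Sum>x\<in>UNIV. \<psi> x)"
    using assms by (simp add: char_group_def sum_distrib_left)
  finally have "(\<psi> t - 1) * (\<Sum>x\<in>UNIV. \<psi> x) = 0"
    by (simp add: algebra_simps)
  then show ?thesis using assms by simp
qed

section \<open>Convolution and translation-invariant matrices\<close>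

definition convolution :: "('g::{finite,ab_group_add} \<Rightarrow> complex) \<Rightarrow> ('g \<Rightarrow> complex) \<Rightarrow> 'g \<Rightarrow> complex"
  where "convolution g h x = (\<Sum>y\<in>UNIV. g (x - y) * h y)"

text \<open>The regular representation: it turns convolution into the matrix product and is
  injective, so questions about adjacency matrices move into the group algebra.\<close>

definition cayley_matrix :: "('g::{finite,ab_group_add} \<Rightarrow> complex) \<Rightarrow> ((complex, 'g) vec, 'g) vec"
  where "cayley_matrix g = (\<chi> x y. g (x - y))"

lemma adjacency_cayley:
  "adjacency_matrix (cayley_relation A) = cayley_matrix (\<lambda>x. of_bool (x \<in> A))"
  by (simp add: adjacency_matrix_def cayley_relation_def cayley_matrix_def vec_eq_iff)

lemma cayley_matrix_mult:
  "cayley_matrix g ** cayley_matrix h = cayley_matrix (convolution g h)"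
proof -
  have "(\<Sum>k\<in>UNIV. g (x - k) * h (k - z)) = (\<Sum>y\<in>UNIV. g (x - z - y) * h y)" for x z
    by (rule sum.reindex_bij_witness[of _ "\<lambda>y. y + z" "\<lambda>y. y - z"]) (auto simp: algebra_simps)
  then show ?thesis
    by (simp add: cayley_matrix_def convolution_def matrix_matrix_mult_def vec_eq_iff)
qed

lemma cayley_matrix_sum:
  "(\<Sum>k\<in>K. c k *\<^sub>M cayley_matrix (g k)) = cayley_matrix (\<lambda>x. \<Sum>k\<in>K. c k * g k x)"
  by (simp add: cayley_matrix_def scale_mat_def vec_eq_iff)

lemma scale_cayley_matrix: "c *\<^sub>M cayley_matrix g = cayley_matrix (\<lambda>x. c * g x)"
  by (simp add: cayley_matrix_def scale_mat_def vec_eq_iff)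

lemma cayley_matrix_eq_iff: "cayley_matrix g = cayley_matrix h \<longleftrightarrow> g = h"
proof
  assume "cayley_matrix g = cayley_matrix h"
  then have "cayley_matrix g $ x $ 0 = cayley_matrix h $ x $ 0" for x by simp
  then show "g = h" by (auto simp: cayley_matrix_def)
qed auto

lemma cayley_matrix_zero: "cayley_matrix (\<lambda>_. 0) = 0"
  by (simp add: cayley_matrix_def vec_eq_iff)

interpretation scale_mat: vector_space "scale_mat :: complex \<Rightarrow> complex^'n^'m \<Rightarrow> complex^'n^'m"
  by unfold_locales (simp_all add: scale_mat_def vec_eq_iff algebra_simps)

lemma convolution_commute: "convolution g h = convolution h g"
proof
  fix x
  have "(\<Sum>y\<in>UNIV. g (x - y) * h y) = (\<Sum>y\<in>UNIV. h (x - y) * g y)"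
    by (rule sum.reindex_bij_witness[of _ "\<lambda>y. x - y" "\<lambda>y. x - y"]) auto
  then show "convolution g h x = convolution h g x" by (simp add: convolution_def)
qed

section \<open>Orthogonality and completeness of the characters\<close>

context self_dual_pairing
begin

lemma pairing_add_left: "\<omega> (a + b) x = \<omega> a x * \<omega> b x"
  by (metis pairing_add pairing_commute)

lemma pairing_minus: "\<omega> a (- x) * \<omega> a x = 1"
  using pairing_add[of a "-x" x] by (simp add: pairing_zero)

lemma pairing_uminus_left: "\<omega> (- a) x = \<omega> a (- x)"
proof -
  have "\<omega> (- a) x * \<omega> a x = 1"
    using pairing_add_left[of "-a" a x] pairing_zero[of x] by (simp add: pairing_commute[of 0])
  then show ?thesis
    using pairing_minus[of a x] by (metis mult.commute mult.left_commute mult_1_right)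
qed

lemma pairing_in_char_group: "\<omega> a \<in> char_group"
  by (simp add: char_group_def pairing_add pairing_zero)

lemma pairing_zero_left: "\<omega> 0 = (\<lambda>_. 1)"
  by (auto simp: pairing_commute[of 0] pairing_zero)

lemma pairing_sum: "(\<Sum>x\<in>UNIV. \<omega> a x) = of_bool (a = 0) * of_nat CARD('g)"
  using char_group_sum_eq_0[OF pairing_in_char_group[of a]] pairing_nontrivial[of a]
  by (cases "a = 0") (auto simp: pairing_zero_left)

lemma pairing_sum_left: "(\<Sum>a\<in>UNIV. \<omega> a x) = of_bool (x = 0) * of_nat CARD('g)"
  using pairing_sum[of x] by (simp add: pairing_commute[of _ x])

text \<open>A character outside the range would be orthogonal to every \<open>\<omega> a\<close>;
  adding up these vanishing inner products isolates the term at 0 and yields the group order, a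
  contradiction.\<close>

lemma char_group_eq_range: "char_group = range \<omega>"
proof
  show "range \<omega> \<subseteq> char_group" by (auto simp: pairing_in_char_group)
  show "char_group \<subseteq> range \<omega>"
  proof
    fix \<psi> :: "'g \<Rightarrow> complex" assume \<psi>: "\<psi> \<in> char_group"
    show "\<psi> \<in> range \<omega>"
    proof (rule ccontr)
      assume nr: "\<psi> \<notin> range \<omega>"
      have "(\<Sum>y\<in>UNIV. \<psi> y * \<omega> a (- y)) = 0" for a
      proof -
        obtain t where t: "\<psi> t \<noteq> \<omega> a t" using nr by (metis ext rangeI)
        have "(\<lambda>y. \<psi> y * \<omega> a (- y)) \<in> char_group"
          using \<psi> by (simp add: char_group_def pairing_add pairing_zero pairing_uminus_left[symmetric])
        moreover have "\<psi> t * \<omega> a (- t) \<noteq> 1"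
          using t pairing_minus[of a t] by (metis mult.commute mult.left_commute mult_1_right)
        ultimately show ?thesis by (rule char_group_sum_eq_0)
      qed
      then have "0 = (\<Sum>a\<in>UNIV. \<Sum>y\<in>UNIV. \<psi> y * \<omega> a (- y))" by simp
      also have "\<dots> = (\<Sum>y\<in>UNIV. \<psi> y * (\<Sum>a\<in>UNIV. \<omega> a (- y)))"
        by (subst sum.swap) (simp add: sum_distrib_left)
      also have "\<dots> = (\<Sum>y\<in>UNIV. if y = 0 then \<psi> y * of_nat CARD('g) else 0)"
        by (rule sum.cong) (auto simp: pairing_sum_left)
      also have "\<dots> = of_nat CARD('g)"
        using \<psi> by (simp add: char_group_def)
      finally show False by simp
    qed
  qed
qed

lemma inj_pairing: "inj \<omega>"
proof (rule injI, rule ccontr)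
  fix a b assume eq: "\<omega> a = \<omega> b" and "a \<noteq> b"
  then obtain x where "\<omega> (a - b) x \<noteq> 1" using pairing_nontrivial[of "a - b"] by auto
  moreover have "\<omega> (a - b) x = 1"
    using pairing_add_left[of a "- b" x] pairing_minus[of b x] eq
    by (simp add: pairing_uminus_left mult.commute)
  ultimately show False by simp
qed

section \<open>The Fourier transform\<close>

definition fourier :: "('g \<Rightarrow> complex) \<Rightarrow> 'g \<Rightarrow> complex"
  where "fourier g a = (\<Sum>x\<in>UNIV. g x * \<omega> a x)"

lemma fourier_inversion: "g x = (\<Sum>a\<in>UNIV. fourier g a * \<omega> a (- x)) / of_nat CARD('g)"
proof -
  have "(\<Sum>a\<in>UNIV. fourier g a * \<omega> a (- x)) = (\<Sum>a\<in>UNIV. \<Sum>y\<in>UNIV. g y * \<omega> a (y - x))"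
    using pairing_add[of _ _ "- x"] by (simp add: fourier_def sum_distrib_right mult.assoc)
  also have "\<dots> = (\<Sum>y\<in>UNIV. g y * (\<Sum>a\<in>UNIV. \<omega> a (y - x)))"
    by (subst sum.swap) (simp add: sum_distrib_left)
  also have "\<dots> = (\<Sum>y\<in>UNIV. if y = x then g y * of_nat CARD('g) else 0)"
    by (rule sum.cong) (auto simp: pairing_sum_left)
  also have "\<dots> = g x * of_nat CARD('g)" by simp
  finally show ?thesis by simp
qed

lemma fourier_inject: "fourier g = fourier h \<Longrightarrow> g = h"
  by (rule ext, subst (1 2) fourier_inversion) simp

lemma fourier_convolution: "fourier (convolution g h) a = fourier g a * fourier h a"
proof -
  have "fourier (convolution g h) a = (\<Sum>x\<in>UNIV. \<Sum>y\<in>UNIV. g (x - y) * h y * \<omega> a x)"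
    by (simp add: fourier_def convolution_def sum_distrib_right)
  also have "\<dots> = (\<Sum>y\<in>UNIV. \<Sum>x\<in>UNIV. g (x - y) * h y * \<omega> a x)"
    by (rule sum.swap)
  also have "\<dots> = (\<Sum>y\<in>UNIV. \<Sum>x\<in>UNIV. g x * h y * \<omega> a (x + y))"
  proof (rule sum.cong[OF refl])
    fix y
    show "(\<Sum>x\<in>UNIV. g (x - y) * h y * \<omega> a x) = (\<Sum>x\<in>UNIV. g x * h y * \<omega> a (x + y))"
      by (rule sum.reindex_bij_witness[of _ "\<lambda>x. x + y" "\<lambda>x. x - y"]) auto
  qed
  also have "\<dots> = (\<Sum>y\<in>UNIV. \<Sum>x\<in>UNIV. (g x * \<omega> a x) * (h y * \<omega> a y))"
    by (simp add: pairing_add ac_simps)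
  also have "\<dots> = fourier g a * fourier h a"
    by (subst sum.swap) (simp add: fourier_def sum_product)
  finally show ?thesis .
qed

lemma fourier_indicator: "fourier (\<lambda>x. of_bool (x \<in> A)) a = char_sum (\<omega> a) A"
proof -
  have "fourier (\<lambda>x. of_bool (x \<in> A)) a = (\<Sum>x\<in>UNIV. if x \<in> A then \<omega> a x else 0)"
    unfolding fourier_def by (rule sum.cong) auto
  then show ?thesis by (simp add: char_sum_def sum.If_cases)
qed

lemma fourier_sum: "fourier (\<lambda>x. \<Sum>k\<in>K. c k * g k x) a = (\<Sum>k\<in>K. c k * fourier (g k) a)"
proof -
  have "fourier (\<lambda>x. \<Sum>k\<in>K. c k * g k x) a = (\<Sum>x\<in>UNIV. \<Sum>k\<in>K. c k * (g k x * \<omega> a x))"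
    by (simp add: fourier_def sum_distrib_right mult.assoc)
  also have "\<dots> = (\<Sum>k\<in>K. \<Sum>x\<in>UNIV. c k * (g k x * \<omega> a x))" by (rule sum.swap)
  finally show ?thesis by (simp add: fourier_def sum_distrib_left)
qed

end

section \<open>Schur rings from character tables\<close>

text \<open>Classes of either partition may be empty, so that one character table serves all cases.\<close>

locale character_table = self_dual_pairing \<omega>
  for \<omega> :: "'g::{finite,ab_group_add} \<Rightarrow> 'g \<Rightarrow> complex" +
  fixes K :: "nat set" and S T :: "nat \<Rightarrow> 'g set" and P Q :: "nat \<Rightarrow> nat \<Rightarrow> complex"
  assumes finite_K: "finite K" and zero_K: "0 \<in> K"
    and S_zero: "S 0 = {0}" and T_zero: "T 0 = {0}"
    and S_disjoint: "disjoint_family_on S K" and S_cover: "(\<Union>i\<in>K. S i) = UNIV"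
    and T_disjoint: "disjoint_family_on T K" and T_cover: "(\<Union>i\<in>K. T i) = UNIV"
    and S_uminus: "i \<in> K \<Longrightarrow> \<exists>i'\<in>K. uminus ` S i = S i'"
    and char_sum_S: "i \<in> K \<Longrightarrow> j \<in> K \<Longrightarrow> a \<in> T j \<Longrightarrow> char_sum (\<omega> a) (S i) = P j i"
    and P_Q: "j \<in> K \<Longrightarrow> k \<in> K \<Longrightarrow> (\<Sum>i\<in>K. P j i * Q i k) = of_bool (j = k) * of_nat CARD('g)"
begin

text \<open>By Fourier inversion, the function whose transform is the indicator of
  \<open>T k\<close>; under convolution these are orthogonal idempotents.\<close>

definition idem :: "nat \<Rightarrow> 'g \<Rightarrow> complex"
  where "idem k x = (\<Sum>b\<in>T k. \<omega> b (- x)) / of_nat CARD('g)"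

lemma T_unique: "j \<in> K \<Longrightarrow> k \<in> K \<Longrightarrow> a \<in> T j \<Longrightarrow> a \<in> T k \<Longrightarrow> j = k"
  using T_disjoint by (auto simp: disjoint_family_on_def)

lemma S_unique: "j \<in> K \<Longrightarrow> k \<in> K \<Longrightarrow> a \<in> S j \<Longrightarrow> a \<in> S k \<Longrightarrow> j = k"
  using S_disjoint by (auto simp: disjoint_family_on_def)

lemma sum_over_T:
  assumes "j \<in> K" "a \<in> T j" shows "(\<Sum>k\<in>K. c k * of_bool (a \<in> T k)) = (c j :: complex)"
proof -
  have "(\<Sum>k\<in>K. c k * of_bool (a \<in> T k)) = (\<Sum>k\<in>K. if k = j then c k else 0)"
    by (rule sum.cong) (use T_unique assms in auto)
  then show ?thesis using assms finite_K by simp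
qed

lemma sum_over_S:
  assumes "j \<in> K" "a \<in> S j" shows "(\<Sum>k\<in>K. c k * of_bool (a \<in> S k)) = (c j :: complex)"
proof -
  have "(\<Sum>k\<in>K. c k * of_bool (a \<in> S k)) = (\<Sum>k\<in>K. if k = j then c k else 0)"
    by (rule sum.cong) (use S_unique assms in auto)
  then show ?thesis using assms finite_K by simp
qed

lemma fourier_idem: "fourier (idem k) a = of_bool (a \<in> T k)"
proof -
  have "fourier (idem k) a = (\<Sum>x\<in>UNIV. \<Sum>b\<in>T k. \<omega> (a - b) x) / of_nat CARD('g)"
    unfolding fourier_def idem_def sum_divide_distrib sum_distrib_right
    by (simp add: pairing_uminus_left[symmetric] pairing_add_left[symmetric])
  also have "\<dots> = (\<Sum>b\<in>T k. \<Sum>x\<in>UNIV. \<omega> (a - b) x) / of_nat CARD('g)"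
    by (subst sum.swap) simp
  also have "\<dots> = (\<Sum>b\<in>T k. if b = a then 1 else 0)"
    by (auto simp: pairing_sum sum_divide_distrib intro!: sum.cong)
  finally show ?thesis by simp
qed

text \<open>Both sides have transform \<open>P j i\<close> on each \<open>T j\<close>, because the
  character sums over \<open>S i\<close> are constant there.\<close>

lemma indicator_S: "i \<in> K \<Longrightarrow> (\<lambda>x. of_bool (x \<in> S i)) = (\<lambda>x. \<Sum>j\<in>K. P j i * idem j x)"
proof (rule fourier_inject, rule ext)
  fix a assume i: "i \<in> K"
  obtain j where j: "j \<in> K" "a \<in> T j" using T_cover by blast
  then show "fourier (\<lambda>x. of_bool (x \<in> S i)) a = fourier (\<lambda>x. \<Sum>j\<in>K. P j i * idem j x) a"
    using i by (simp add: fourier_indicator fourier_sum fourier_idem sum_over_T char_sum_S del: of_bool_eq_iff sum_mult_of_bool_eq)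
qed

text \<open>After expanding each indicator in the idempotents, \<open>P_Q\<close> leaves only the
  k-th one.\<close>

lemma idem_S:
  assumes "k \<in> K"
  shows "idem k = (\<lambda>x. 1 / of_nat CARD('g) * (\<Sum>i\<in>K. Q i k * of_bool (x \<in> S i)))"
proof
  fix x
  have "(\<Sum>i\<in>K. Q i k * of_bool (x \<in> S i)) = (\<Sum>i\<in>K. Q i k * (\<Sum>j\<in>K. P j i * idem j x))"
    using indicator_S[THEN fun_cong, of _ x] by (intro sum.cong) auto
  also have "\<dots> = (\<Sum>j\<in>K. \<Sum>i\<in>K. (P j i * Q i k) * idem j x)"
    unfolding sum_distrib_left by (subst sum.swap) (simp add: ac_simps)
  also have "\<dots> = (\<Sum>j\<in>K. if j = k then of_nat CARD('g) * idem j x else 0)"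
    using assms by (auto simp: sum_distrib_right[symmetric] P_Q intro!: sum.cong)
  also have "\<dots> = of_nat CARD('g) * idem k x"
    using assms finite_K by simp
  finally show "idem k x = 1 / of_nat CARD('g) * (\<Sum>i\<in>K. Q i k * of_bool (x \<in> S i))" by simp
qed

lemma convolution_idem: "j \<in> K \<Longrightarrow> k \<in> K \<Longrightarrow> convolution (idem j) (idem k) = (if j = k then idem j else (\<lambda>_. 0))"
  by (rule fourier_inject, rule ext)
     (use T_unique in \<open>auto simp: fourier_convolution fourier_idem fourier_def[of "\<lambda>_. 0"]\<close>)

section \<open>The association scheme on the nonempty classes\<close>

abbreviation classes :: "nat set" where "classes \<equiv> {i \<in> K. S i \<noteq> {}}"

text \<open>The Schur ring property. Transforms multiply pointwise, so the convolution is a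
  combination of the functions \<open>idem k\<close>, each of which is constant on every class by
  \<open>idem_S\<close>.\<close>

lemma convolution_constant:
  assumes "i \<in> K" "j \<in> K" "l \<in> K" "x \<in> S l" "y \<in> S l"
  defines "g \<equiv> convolution (\<lambda>x. of_bool (x \<in> S i)) (\<lambda>x. of_bool (x \<in> S j))"
  shows "g x = g y"
proof -
  have "g = (\<lambda>x. \<Sum>k\<in>K. (P k i * P k j) * idem k x)"
  proof (rule fourier_inject, rule ext)
    fix a obtain m where "m \<in> K" "a \<in> T m" using T_cover by blast
    then show "fourier g a = fourier (\<lambda>x. \<Sum>k\<in>K. (P k i * P k j) * idem k x) a"
      using assms by (simp add: g_def fourier_convolution fourier_indicator fourier_sum
        fourier_idem sum_over_T char_sum_S del: of_bool_eq_iff sum_mult_of_bool_eq)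
  qed
  moreover have "idem k x = idem k y" if "k \<in> K" for k
    using assms that by (simp add: idem_S sum_over_S del: sum_mult_of_bool_eq)
  ultimately show ?thesis by simp
qed

lemma inj_on_S: "inj_on S classes"
  using S_unique by (fastforce simp: inj_on_def)

lemma partition_S: "partition_on UNIV (S ` classes)"
proof (rule partition_onI)
  show "\<Union> (S ` classes) = UNIV" using S_cover by fastforce
  show "disjnt p q" if "p \<in> S ` classes" "q \<in> S ` classes" "p \<noteq> q" for p q
    using that S_unique by (auto simp: disjnt_def)
qed auto

lemma inj_cayley_relation: "inj (cayley_relation :: 'g set \<Rightarrow> _)"
proof (rule injI)
  fix A B :: "'g set" assume eq: "cayley_relation A = cayley_relation B"
  have "A = {x. (x, 0) \<in> cayley_relation A}" for A :: "'g set"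
    by (simp add: cayley_relation_def)
  then show "A = B" using eq by metis
qed

lemma association_scheme_classes: "association_scheme classes (\<lambda>i. cayley_relation (S i))"
  unfolding association_scheme_def
proof (intro conjI ballI)
  show "finite classes" using finite_K by simp
  show "0 \<in> classes" using zero_K S_zero by simp
  show "inj_on (\<lambda>i. cayley_relation (S i)) classes"
    using inj_on_S inj_cayley_relation by (auto simp: inj_on_def)
  show "partition_on UNIV ((\<lambda>i. cayley_relation (S i)) ` classes)"
  proof (rule partition_onI)
    show "\<Union> ((\<lambda>i. cayley_relation (S i)) ` classes) = UNIV"
      using S_cover by (fastforce simp: cayley_relation_def)
    show "{} \<notin> (\<lambda>i. cayley_relation (S i)) ` classes"
    proof
      assume "{} \<in> (\<lambda>i. cayley_relation (S i)) ` classes"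
      then obtain i x where "cayley_relation (S i) = {}" "x \<in> S i" by auto
      then show False by (auto simp: cayley_relation_def) (metis diff_zero)
    qed
    show "disjnt p q" if p: "p \<in> (\<lambda>i. cayley_relation (S i)) ` classes"
      "q \<in> (\<lambda>i. cayley_relation (S i)) ` classes" "p \<noteq> q" for p q
      using that S_unique by (auto simp: disjnt_def cayley_relation_def)
  qed
  show "cayley_relation (S 0) = Id" by (auto simp: S_zero cayley_relation_def)
next
  fix i assume i: "i \<in> classes"
  then obtain i' where i': "i' \<in> K" "uminus ` S i = S i'" using S_uminus by blast
  have "(cayley_relation (S i))\<inverse> = cayley_relation (uminus ` S i)"
  proof -
    have "x \<in> uminus ` S i \<longleftrightarrow> - x \<in> S i" for x by (metis imageE imageI minus_minus)
    then show ?thesis by (auto simp: cayley_relation_def)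
  qed
  then show "\<exists>i'\<in>classes. (cayley_relation (S i))\<inverse> = cayley_relation (S i')"
    using i i' by (intro bexI[of _ i']) auto
next
  fix i j assume i: "i \<in> classes" and j: "j \<in> classes"
  define g where "g = convolution (\<lambda>x. of_bool (x \<in> S i)) (\<lambda>x. of_bool (x \<in> S j))"
  \<comment> \<open>The convolution counts representations, so the structure constants are natural
    numbers.\<close>
  define p where "p x = card {y. x - y \<in> S i \<and> y \<in> S j}" for x
  have g: "g x = of_nat (p x)" for x
  proof -
    have "g x = (\<Sum>y\<in>UNIV. of_bool (y \<in> {y. x - y \<in> S i \<and> y \<in> S j}))"
      unfolding g_def convolution_def by (rule sum.cong) auto
    then show ?thesis by (simp add: p_def)
  qed
  \<comment> \<open>Any representative serves, since the count is constant on
    \<open>S l\<close>.\<close>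
  define c where "c l = p (SOME x. x \<in> S l)" for l
  have "g x = (\<Sum>l\<in>classes. of_nat (c l) * of_bool (x \<in> S l))" for x
  proof -
    obtain l where l: "l \<in> K" "x \<in> S l" using S_cover by blast
    then have "(SOME x. x \<in> S l) \<in> S l" by (intro someI)
    then have "g x = of_nat (c l)"
      using convolution_constant[of i j l x "SOME x. x \<in> S l"] i j l g by (simp add: c_def g_def)
    also have "\<dots> = (\<Sum>l\<in>K. of_nat (c l) * of_bool (x \<in> S l))"
      using l by (subst sum_over_S) auto
    also have "\<dots> = (\<Sum>l\<in>classes. of_nat (c l) * of_bool (x \<in> S l))"
      using finite_K by (intro sum.mono_neutral_right) auto
    finally show ?thesis .
  qed
  then have "g = (\<lambda>x. \<Sum>l\<in>classes. of_nat (c l) * of_bool (x \<in> S l))" by blast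
  then have "adjacency_matrix (cayley_relation (S i)) ** adjacency_matrix (cayley_relation (S j)) =
     (\<Sum>l\<in>classes. of_nat (c l) *\<^sub>M adjacency_matrix (cayley_relation (S l)))"
    unfolding adjacency_cayley cayley_matrix_mult cayley_matrix_sum g_def by (rule arg_cong)
  then show "\<exists>p :: nat \<Rightarrow> nat.
      adjacency_matrix (cayley_relation (S i)) ** adjacency_matrix (cayley_relation (S j)) =
      (\<Sum>l\<in>classes. of_nat (p l) *\<^sub>M adjacency_matrix (cayley_relation (S l)))" by blast
  show "adjacency_matrix (cayley_relation (S i)) ** adjacency_matrix (cayley_relation (S j)) =
      adjacency_matrix (cayley_relation (S j)) ** adjacency_matrix (cayley_relation (S i))"
    by (simp add: adjacency_cayley cayley_matrix_mult convolution_commute)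
qed

lemma schur_ring_classes: "schur_ring classes S"
  by (simp add: schur_ring_def inj_on_S partition_S association_scheme_classes)

text \<open>Equal rows j and k of P would agree in column j of P Q, where the entries are the group
  order and 0. At an empty class both rows are 0, so testing the nonempty classes determines the
  whole row.\<close>

lemma row_distinct:
  assumes "j \<in> K" "k \<in> K" "a \<in> T j" "b \<in> T k"
    and eq: "\<And>i. i \<in> classes \<Longrightarrow> char_sum (\<omega> a) (S i) = char_sum (\<omega> b) (S i)"
  shows "j = k"
proof (rule ccontr)
  assume "j \<noteq> k"
  have "P j i = P k i" if "i \<in> K" for i
    using assms char_sum_S[of i j a] char_sum_S[of i k b] that
    by (cases "S i = {}") (auto simp: char_sum_def)
  then have "(\<Sum>i\<in>K. P j i * Q i j) = (\<Sum>i\<in>K. P k i * Q i j)" by simp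
  then show False using P_Q[of j j] P_Q[of k j] \<open>j \<noteq> k\<close> assms by simp
qed

lemma schur_dual_classes: "schur_dual classes S {j \<in> K. T j \<noteq> {}} (\<lambda>j. \<omega> ` T j)"
  unfolding schur_dual_def
proof (intro conjI)
  show "0 \<in> {j \<in> K. T j \<noteq> {}}" using zero_K T_zero by simp
  show "\<omega> ` T 0 = {\<lambda>_. 1}" by (simp add: T_zero pairing_zero_left)
  have class_eq: "dual_equiv classes S `` {\<omega> a} = \<omega> ` T j" if "j \<in> K" "a \<in> T j" for a j
  proof -
    have "(\<omega> a, \<omega> b) \<in> dual_equiv classes S \<longleftrightarrow> b \<in> T j" for b
    proof
      obtain k where k: "k \<in> K" "b \<in> T k" using T_cover by blast
      assume "(\<omega> a, \<omega> b) \<in> dual_equiv classes S"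
      then have "j = k" using row_distinct[of j k a b] that k by (simp add: dual_equiv_def)
      then show "b \<in> T j" using k by simp
    next
      assume "b \<in> T j"
      then show "(\<omega> a, \<omega> b) \<in> dual_equiv classes S"
        using that by (simp add: dual_equiv_def pairing_in_char_group char_sum_S)
    qed
    moreover have "dual_equiv classes S `` {\<omega> a} \<subseteq> range \<omega>"
      by (auto simp: dual_equiv_def char_group_eq_range)
    ultimately show ?thesis by blast
  qed
  show "bij_betw (\<lambda>j. \<omega> ` T j) {j \<in> K. T j \<noteq> {}} (char_group // dual_equiv classes S)"
    unfolding bij_betw_def
  proof
    show "inj_on (\<lambda>j. \<omega> ` T j) {j \<in> K. T j \<noteq> {}}"
      using T_unique inj_pairing by (fastforce simp: inj_on_def inj_image_eq_iff)
    show "(\<lambda>j. \<omega> ` T j) ` {j \<in> K. T j \<noteq> {}} = char_group // dual_equiv classes S"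
    proof
      show "(\<lambda>j. \<omega> ` T j) ` {j \<in> K. T j \<noteq> {}} \<subseteq> char_group // dual_equiv classes S"
      proof
        fix X assume "X \<in> (\<lambda>j. \<omega> ` T j) ` {j \<in> K. T j \<noteq> {}}"
        then obtain j a where "j \<in> K" "a \<in> T j" "X = \<omega> ` T j" by blast
        then show "X \<in> char_group // dual_equiv classes S"
          using class_eq[of j a] pairing_in_char_group[of a] by (metis quotientI)
      qed
      show "char_group // dual_equiv classes S \<subseteq> (\<lambda>j. \<omega> ` T j) ` {j \<in> K. T j \<noteq> {}}"
      proof
        fix X assume "X \<in> char_group // dual_equiv classes S"
        then obtain a where a: "X = dual_equiv classes S `` {\<omega> a}"
          by (auto simp: quotient_def char_group_eq_range)
        obtain j where "j \<in> K" "a \<in> T j" using T_cover by blast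
        then show "X \<in> (\<lambda>j. \<omega> ` T j) ` {j \<in> K. T j \<noteq> {}}"
          using class_eq[of j a] a by auto
      qed
    qed
  qed
qed

text \<open>The principal character belongs to class 0, so \<open>P 0 i\<close> is the size of
  \<open>S i\<close>.\<close>

lemma S_nonempty: "i \<in> K \<Longrightarrow> P 0 i \<noteq> 0 \<Longrightarrow> S i \<noteq> {}"
  using char_sum_S[of i 0 0] zero_K T_zero by (auto simp: char_sum_def)

text \<open>At 0 every character is 1, so \<open>idem j 0\<close> is the size of \<open>T j\<close>
  over the group order, while \<open>idem_S\<close> gives \<open>Q 0 j\<close> over the same
  order.\<close>

lemma T_nonempty:
  assumes "j \<in> K" "Q 0 j \<noteq> 0" shows "T j \<noteq> {}"
proof
  assume "T j = {}"
  then have "idem j 0 = 0" by (simp add: idem_def)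
  moreover have "idem j 0 = Q 0 j / of_nat CARD('g)"
    using assms zero_K S_zero by (simp add: idem_S sum_over_S[of 0] del: sum_mult_of_bool_eq)
  ultimately show False using assms by simp
qed

section \<open>Eigenmatrices and the basis of idempotents\<close>

lemma first_eigenmatrix_idem:
  "first_eigenmatrix K (\<lambda>i. cayley_relation (S i)) (\<lambda>k. cayley_matrix (idem k)) P"
  by (simp add: first_eigenmatrix_def adjacency_cayley cayley_matrix_sum cayley_matrix_eq_iff
      indicator_S del: sum_mult_of_bool_eq)

lemma second_eigenmatrix_idem:
  "second_eigenmatrix K (\<lambda>i. cayley_relation (S i)) (\<lambda>k. cayley_matrix (idem k)) Q"
  unfolding second_eigenmatrix_def adjacency_cayley cayley_matrix_sum
  by (simp add: scale_cayley_matrix cayley_matrix_eq_iff idem_S del: sum_mult_of_bool_eq)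

text \<open>The transform of the combination at a point of \<open>T j\<close> is the coefficient
  \<open>c j\<close>.\<close>

lemma idem_independent:
  assumes T: "\<And>j. j \<in> K \<Longrightarrow> T j \<noteq> {}"
    and eq: "(\<Sum>k\<in>K. c k *\<^sub>M cayley_matrix (idem k)) = 0" and "j \<in> K"
  shows "c j = 0"
proof -
  obtain a where a: "a \<in> T j" using T \<open>j \<in> K\<close> by blast
  have "(\<lambda>x. \<Sum>k\<in>K. c k * idem k x) = (\<lambda>_. 0)"
    using eq by (simp add: cayley_matrix_sum cayley_matrix_zero[symmetric] cayley_matrix_eq_iff)
  then have "fourier (\<lambda>x. \<Sum>k\<in>K. c k * idem k x) a = 0" by (simp add: fourier_def)
  then show ?thesis
    using a \<open>j \<in> K\<close> by (simp add: fourier_sum fourier_idem sum_over_T del: sum_mult_of_bool_eq)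
qed

lemma orthogonal_idempotent_basis_idem:
  assumes T: "\<And>j. j \<in> K \<Longrightarrow> T j \<noteq> {}"
  shows "orthogonal_idempotent_basis K (\<lambda>i. cayley_relation (S i)) (\<lambda>k. cayley_matrix (idem k))"
  unfolding orthogonal_idempotent_basis_def
proof (intro conjI ballI impI)
  let ?E = "\<lambda>k. cayley_matrix (idem k)" and ?A = "\<lambda>i. adjacency_matrix (cayley_relation (S i))"
  show inj: "inj_on ?E K"
  proof (rule inj_onI)
    fix j k assume jk: "j \<in> K" "k \<in> K" "?E j = ?E k"
    obtain a where "a \<in> T j" using T jk by blast
    moreover have "fourier (idem j) a = fourier (idem k) a" using jk by (simp add: cayley_matrix_eq_iff)
    ultimately show "j = k" using jk T_unique by (auto simp: fourier_idem split: if_splits)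
  qed
  show "\<not> scale_mat.dependent (?E ` K)"
  proof
    assume "scale_mat.dependent (?E ` K)"
    then obtain u v where uv: "(\<Sum>v\<in>?E ` K. u v *\<^sub>M v) = 0" "v \<in> ?E ` K" "u v \<noteq> 0"
      using finite_K by (auto simp: scale_mat.dependent_finite)
    then have "(\<Sum>k\<in>K. u (?E k) *\<^sub>M ?E k) = 0" by (simp add: sum.reindex[OF inj])
    then show False using idem_independent[of "\<lambda>k. u (?E k)"] T uv by auto
  qed
  \<comment> \<open>The two eigenmatrix identities express each family through the other.\<close>
  show "scale_mat.span (?E ` K) = scale_mat.span (?A ` K)"
  proof (subst scale_mat.span_eq, intro conjI subsetI)
    fix M assume "M \<in> ?E ` K"
    then obtain k where k: "k \<in> K" "M = ?E k" by blast
    then have "M = (1 / of_nat CARD('g)) *\<^sub>M (\<Sum>j\<in>K. Q j k *\<^sub>M ?A j)"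
      using second_eigenmatrix_idem by (simp add: second_eigenmatrix_def)
    then show "M \<in> scale_mat.span (?A ` K)"
      by (simp only:) (intro scale_mat.span_scale scale_mat.span_sum scale_mat.span_base imageI)
  next
    fix M assume "M \<in> ?A ` K"
    then obtain i where i: "i \<in> K" "M = ?A i" by blast
    then have "M = (\<Sum>j\<in>K. P j i *\<^sub>M ?E j)"
      using first_eigenmatrix_idem by (simp add: first_eigenmatrix_def)
    then show "M \<in> scale_mat.span (?E ` K)"
      by (simp only:) (intro scale_mat.span_scale scale_mat.span_sum scale_mat.span_base imageI)
  qed
next
  fix j assume "j \<in> K"
  then show "cayley_matrix (idem j) ** cayley_matrix (idem j) = cayley_matrix (idem j)"
    by (simp add: cayley_matrix_mult convolution_idem)
next
  fix j k assume "j \<in> K" "k \<in> K" "j \<noteq> k"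
  then show "cayley_matrix (idem j) ** cayley_matrix (idem k) = 0"
    by (simp add: cayley_matrix_mult convolution_idem cayley_matrix_zero)
qed

end

section \<open>The Galois ring and its trace pairing\<close>

locale galois_ring =
  fixes n :: nat and \<xi> :: "'r::{finite,comm_ring_1}"
  assumes galois: "galois_ring_4 TYPE('r) n"
    and generator: "teich_generator n \<xi>"
begin

abbreviation q :: nat where "q \<equiv> 2 ^ n"
definition Z :: "'r set" where "Z = range (\<lambda>x. 2 * x)"
abbreviation T :: "'r set" where "T \<equiv> teich n \<xi>"

lemma of_nat_eq_0_iff: "(of_nat k :: 'r) = 0 \<longleftrightarrow> 4 dvd k"
  using galois by (simp add: galois_ring_4_def of_nat_eq_0_iff_char_dvd)

lemma four_eq_0 [simp]: "(4 :: 'r) = 0"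
  using of_nat_eq_0_iff[of 4] by simp

lemma two_neq_0: "(2 :: 'r) \<noteq> 0"
  using of_nat_eq_0_iff[of 2] by simp

lemma card_ring: "CARD('r) = q * q"
  using galois by (simp add: galois_ring_4_def power_mult_distrib[symmetric])

lemma n_pos: "n > 0"
proof (rule ccontr)
  assume "\<not> n > 0"
  then have "CARD('r) = 1" using card_ring by simp
  then have "(2 :: 'r) = 0" by (metis (mono_tags, opaque_lifting) card_1_singletonE UNIV_I singletonD)
  then show False using two_neq_0 by simp
qed

lemma q_ge_2: "q \<ge> 2"
  using n_pos by (cases n) auto

lemma q_double: "q = 2 * 2 ^ (n - 1)"
  using n_pos by (cases n) auto

section \<open>The ideal Z and congruence modulo Z\<close>

lemma two_mult_two: "2 * (2 * x) = (0 :: 'r)"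
  using four_eq_0 by (simp add: mult.assoc[symmetric])

text \<open>Z is both image and kernel of doubling: an x with 2 x = 0 is a zero divisor or 0, hence
  lies in the ideal generated by 2.\<close>

lemma Z_iff: "x \<in> Z \<longleftrightarrow> 2 * x = 0"
proof
  show "2 * x = 0" if "x \<in> Z" using that two_mult_two by (auto simp: Z_def)
  assume "2 * x = 0"
  then have "\<exists>y. y \<noteq> 0 \<and> x * y = 0" using two_neq_0 by (metis mult.commute)
  then show "x \<in> Z" using galois by (auto simp: galois_ring_4_def Z_def)
qed

lemma two_mult_in_Z: "2 * x \<in> Z"
  by (simp add: Z_def)

lemma ZE: assumes "x \<in> Z" obtains u where "x = 2 * u"
  using assms by (auto simp: Z_def)

lemma nonzero_divisor: "x \<notin> Z \<Longrightarrow> x * y = 0 \<Longrightarrow> y = 0"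
  using galois by (auto simp: galois_ring_4_def Z_def)

lemma mult_left_inject: "x \<notin> Z \<Longrightarrow> x * y = x * z \<longleftrightarrow> y = z"
  using nonzero_divisor[of x "y - z"] by (auto simp: algebra_simps)

lemma Z_mult: "x * y \<in> Z \<longleftrightarrow> x \<in> Z \<or> y \<in> Z"
proof
  assume "x * y \<in> Z"
  then have "x * (2 * y) = 0" by (simp add: Z_iff mult.left_commute)
  then show "x \<in> Z \<or> y \<in> Z" using nonzero_divisor[of x "2 * y"] Z_iff[of y] by blast
next
  show "x * y \<in> Z" if "x \<in> Z \<or> y \<in> Z"
    using that by (auto simp: Z_iff mult.assoc[symmetric]) (simp add: mult.commute mult.left_commute)
qed

text \<open>This is the form in which congruence modulo Z is used below: as an equality after
  doubling.\<close>

lemma diff_in_Z: "x - y \<in> Z \<longleftrightarrow> 2 * x = 2 * y"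
  by (simp add: Z_iff right_diff_distrib)

lemma two_mult_minus: "2 * (- x) = (2 * x :: 'r)"
  using two_mult_two[of x] by (simp add: eq_neg_iff_add_eq_0 minus_equation_iff)

text \<open>Doubling maps R onto Z with translates of Z as fibres, so the order of R is the square
  of \<open>card Z\<close>.\<close>

lemma card_Z: "card Z = q"
proof -
  have "card {x. 2 * x = 2 * y} = card Z" for y :: 'r
  proof (rule bij_betw_same_card)
    show "bij_betw (\<lambda>x. x - y) {x. 2 * x = 2 * y} Z"
      by (rule bij_betwI[where g = "\<lambda>x. x + y"]) (auto simp: diff_in_Z distrib_left Z_iff right_diff_distrib)
  qed
  then have "card {x. 2 * x = z} = card Z" if "z \<in> Z" for z using that by (auto elim: ZE)
  moreover have "CARD('r) = (\<Sum>z\<in>Z. card {x. 2 * x = z})"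
    using sum.image_gen[of "UNIV :: 'r set" "\<lambda>_. 1 :: nat" "\<lambda>x. 2 * x"] by (simp add: Z_def)
  ultimately have "CARD('r) = card Z * card Z" by simp
  then have "card Z ^ 2 = q ^ 2" using card_ring by (simp add: power2_eq_square)
  then show ?thesis by (rule power2_eq_imp_eq) auto
qed

lemma power_cong_Z: "2 * x = 2 * y \<Longrightarrow> 2 * x ^ k = 2 * (y :: 'r) ^ k"
proof (induction k)
  case (Suc k)
  then have "2 * x ^ Suc k = x * (2 * y ^ k)" by (simp add: mult.left_commute)
  also have "\<dots> = (2 * x) * y ^ k" by (simp add: ac_simps)
  finally show ?case using Suc.prems by (simp add: mult.assoc)
qed simp

text \<open>Squaring lifts a congruence modulo 2 to an equality, because every correction term
  carries a factor 4.\<close>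

lemma square_cong_Z:
  assumes "2 * x = 2 * y" shows "x ^ 2 = (y :: 'r) ^ 2"
proof -
  obtain z where "x = y + 2 * z" using assms diff_in_Z[of x y] by (metis ZE diff_eq_eq add.commute)
  then have "x ^ 2 = y ^ 2 + 4 * (y * z + z ^ 2)" by (simp add: power2_eq_square algebra_simps)
  then show ?thesis by (simp add: four_eq_0)
qed

lemma power_q_cong_Z: "2 * x = 2 * y \<Longrightarrow> x ^ q = (y :: 'r) ^ q"
  using square_cong_Z[of x y] by (simp only: q_double power_mult)

lemma two_mult_add_power: "2 * (x + y) ^ 2 ^ k = 2 * x ^ 2 ^ k + (2 * y ^ 2 ^ k :: 'r)"
proof (induction k)
  case (Suc k)
  let ?x = "x ^ 2 ^ k" and ?y = "y ^ 2 ^ k"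
  have "2 * (x + y) ^ 2 ^ Suc k = 2 * ((x + y) ^ 2 ^ k) ^ 2"
    by (simp add: power_mult[symmetric] mult.commute)
  also have "\<dots> = 2 * (?x + ?y) ^ 2"
    using Suc by (intro power_cong_Z) (simp add: algebra_simps)
  also have "\<dots> = 2 * ?x ^ 2 + 2 * ?y ^ 2 + 2 * (2 * (?x * ?y))"
    by (simp add: power2_eq_square algebra_simps)
  also have "\<dots> = 2 * x ^ 2 ^ Suc k + 2 * y ^ 2 ^ Suc k"
    by (simp add: power_mult[symmetric] mult.commute)
  finally show ?case .
qed (simp add: distrib_left)

section \<open>The Teichmueller system and the two digits of an element\<close>

lemma generator_power: "\<xi> ^ (q - Suc 0) = 1"
  and generator_order: "0 < k \<Longrightarrow> k < q - 1 \<Longrightarrow> \<xi> ^ k \<noteq> 1"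
  using generator by (auto simp: teich_generator_def)

text \<open>Z is prime and does not contain 1, so a power of \<xi> in Z would put \<xi>, and then
  \<open>\<xi> ^ (q - 1) = 1\<close>, into Z.\<close>

lemma generator_power_notin_Z: "\<xi> ^ k \<notin> Z"
proof
  have "1 \<notin> Z" using two_neq_0 by (simp add: Z_iff)
  then have "\<xi> ^ (q - 1) \<notin> Z" by (simp add: generator_power)
  moreover assume "\<xi> ^ k \<in> Z"
  then have "\<xi> \<in> Z" using \<open>1 \<notin> Z\<close> by (induction k) (auto simp: Z_mult)
  then have "\<xi> * \<xi> ^ (q - 2) \<in> Z" by (simp add: Z_mult)
  then have "\<xi> ^ Suc (q - 2) \<in> Z" by simp
  moreover have "q - 1 = Suc (q - 2)" using q_ge_2 by simp
  ultimately show False by metis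
qed

lemma inj_generator_power: "inj_on (\<lambda>i. \<xi> ^ i) {..<q - 1}"
proof (rule linorder_inj_onI)
  fix i j assume ij: "i < j" "i \<in> {..<q - 1}" "j \<in> {..<q - 1}"
  then have "\<xi> ^ (j - i) \<noteq> 1" by (intro generator_order) auto
  then have "\<xi> ^ i * \<xi> ^ (j - i) \<noteq> \<xi> ^ i * 1"
    using mult_left_inject[OF generator_power_notin_Z] by blast
  then show "\<xi> ^ i \<noteq> \<xi> ^ j" using ij by (simp add: power_add[symmetric])
qed auto

lemma teich_eq: "T = insert 0 ((\<lambda>i. \<xi> ^ i) ` {..<q - 1})"
proof -
  have "i \<le> q - 2 \<longleftrightarrow> i < q - 1" for i using q_ge_2 by linarith
  then show ?thesis by (auto simp: teich_def)
qed

lemma card_teich: "card T = q"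
proof -
  have "0 \<notin> (\<lambda>i. \<xi> ^ i) ` {..<q - 1}"
    using generator_power_notin_Z Z_iff[of 0] by (metis imageE mult_zero_right)
  moreover have "card ((\<lambda>i. \<xi> ^ i) ` {..<q - 1}) = q - 1"
    by (simp only: card_image[OF inj_generator_power] card_lessThan)
  ultimately show ?thesis
    using q_ge_2 by (simp add: teich_eq)
qed

lemma teich_power_q: "t \<in> T \<Longrightarrow> t ^ q = t"
proof -
  have "(\<xi> ^ i) ^ q = (\<xi> ^ i)" for i
  proof -
    have "(\<xi> ^ i) ^ q = (\<xi> ^ (q - 1)) ^ i * \<xi> ^ i"
      using q_ge_2 by (simp add: power_mult[symmetric] power_add[symmetric] algebra_simps)
    then show ?thesis by (simp add: generator_power)
  qed
  then show "t ^ q = t" if "t \<in> T" using that q_ge_2 by (auto simp: teich_eq zero_power)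
qed

text \<open>The q-th power depends only on the class modulo Z and fixes T pointwise, so T meets
  every class at most once. Counting then makes it a transversal.\<close>

lemma teich_inject: "x \<in> T \<Longrightarrow> y \<in> T \<Longrightarrow> 2 * x = 2 * y \<longleftrightarrow> x = y"
  using power_q_cong_Z[of x y] teich_power_q by auto

lemma two_mult_teich: "(\<lambda>x. 2 * x) ` T = Z"
proof (rule card_subset_eq)
  have "inj_on (\<lambda>x. 2 * x) T" by (rule inj_onI) (simp add: teich_inject)
  then show "card ((\<lambda>x. 2 * x) ` T) = card Z" by (simp add: card_image card_teich card_Z)
qed (auto simp: Z_def)

lemma teich_transversal: obtains t where "t \<in> T" "2 * t = 2 * x"
  using two_mult_teich by (metis imageE two_mult_in_Z)

text \<open>The q-th power picks the Teichmueller representative of the class of x modulo Z.\<close>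

lemma power_q_in_teich: "x ^ q \<in> T" and two_mult_power_q: "2 * x ^ q = 2 * x"
proof -
  obtain t where "t \<in> T" "2 * t = 2 * x" by (rule teich_transversal)
  then have "x ^ q = t" using power_q_cong_Z teich_power_q by metis
  then show "x ^ q \<in> T" "2 * x ^ q = 2 * x" using \<open>t \<in> T\<close> \<open>2 * t = 2 * x\<close> by auto
qed

lemma teich_iff: "t \<in> T \<longleftrightarrow> t ^ q = t"
  using power_q_in_teich[of t] teich_power_q by auto

lemma zero_in_teich: "0 \<in> T"
  by (simp add: teich_eq)

lemma teich_mult: "x \<in> T \<Longrightarrow> y \<in> T \<Longrightarrow> x * y \<in> T"
  and teich_power: "x \<in> T \<Longrightarrow> x ^ k \<in> T"
  by (simp_all add: teich_iff power_mult_distrib) (simp add: power_mult[symmetric] mult.commute[of k], simp add: power_mult)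

lemma representation: obtains a b where "a \<in> T" "b \<in> T" "x = a + 2 * b"
proof -
  have "x - x ^ q \<in> Z" by (simp add: diff_in_Z two_mult_power_q)
  then obtain b where "b \<in> T" "x - x ^ q = 2 * b" using two_mult_teich by (metis imageE)
  then show ?thesis using that[of "x ^ q" b] power_q_in_teich by (simp add: algebra_simps)
qed

lemma representation_unique:
  assumes "a + 2 * b = a' + 2 * b'" "a \<in> T" "b \<in> T" "a' \<in> T" "b' \<in> T"
  shows "a = a'" "b = b'"
proof -
  have "2 * (a + 2 * b) = 2 * (a' + 2 * b')" by (simp only: assms)
  then have "2 * a = 2 * a'" unfolding distrib_left two_mult_two by simp
  then show "a = a'" using assms(2,4) by (simp add: teich_inject)
  then show "b = b'" using assms by (simp add: teich_inject)
qed

section \<open>The field addition on the Teichmueller system\<close>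

lemma gr_sqrt_square: "gr_sqrt n x ^ 2 = x ^ q"
  by (simp add: gr_sqrt_def power_mult[symmetric] q_double mult.commute)

lemma gr_sqrt_mult: "gr_sqrt n (x * y) = gr_sqrt n x * gr_sqrt n (y :: 'r)"
  by (simp add: gr_sqrt_def power_mult_distrib)

lemma oplus_eq_square:
  "x \<in> T \<Longrightarrow> y \<in> T \<Longrightarrow> oplus n x y = (gr_sqrt n x + gr_sqrt n y) ^ 2"
  using gr_sqrt_square[of x] gr_sqrt_square[of y]
  by (simp add: oplus_def power2_sum gr_sqrt_mult teich_power_q mult.assoc)

lemma oplus_in_teich:
  assumes "x \<in> T" "y \<in> T" shows "oplus n x y \<in> T"
proof -
  let ?s = "gr_sqrt n x + gr_sqrt n y"
  have "(?s ^ 2) ^ q = (?s ^ q) ^ 2" by (simp add: power_mult[symmetric] mult.commute)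
  \<comment> \<open>Since \<open>?s ^ q\<close> and \<open>?s\<close> are congruent modulo Z, their
    squares agree, and \<open>?s ^ 2\<close> is fixed by the q-th power.\<close>
  also have "\<dots> = ?s ^ 2" by (rule square_cong_Z) (rule two_mult_power_q)
  finally show ?thesis using assms by (simp add: oplus_eq_square teich_iff)
qed

lemma two_mult_oplus: "2 * oplus n x y = 2 * (x + y :: 'r)"
  by (simp add: oplus_def distrib_left)

section \<open>Frobenius, trace and nondegeneracy of the trace pairing\<close>

lemma frob_eq:
  assumes "a \<in> T" "b \<in> T" shows "frob n \<xi> (a + 2 * b) = a ^ 2 + 2 * b ^ 2"
  unfolding frob_def
proof (rule the_equality)
  fix y assume "\<exists>a'\<in>T. \<exists>b'\<in>T. a + 2 * b = a' + 2 * b' \<and> y = a' ^ 2 + 2 * b' ^ 2"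
  then show "y = a ^ 2 + 2 * b ^ 2" using representation_unique assms by metis
qed (use assms in blast)

text \<open>The second digit enters \<^const>\<open>frob\<close> only modulo \<open>Z\<close>, so it need not be a Teichmueller element.\<close>

lemma frob_eq':
  assumes "a \<in> T" shows "frob n \<xi> (a + 2 * b) = a ^ 2 + 2 * b ^ 2"
proof -
  have "frob n \<xi> (a + 2 * b ^ q) = a ^ 2 + 2 * (b ^ q) ^ 2"
    using assms power_q_in_teich by (rule frob_eq)
  then show ?thesis using power_cong_Z[OF two_mult_power_q[of b], of 2] by (simp add: two_mult_power_q)
qed

lemma frob_add: "frob n \<xi> (x + y) = frob n \<xi> x + frob n \<xi> y"
proof -
  obtain a b where x: "a \<in> T" "x = a + 2 * b" using representation by metis
  obtain c d where y: "c \<in> T" "y = c + 2 * d" using representation by metis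
  \<comment> \<open>The first digit of x + y is \<open>oplus n a c\<close>, which leaves the carry
    -s for the second. Under Frobenius the cross term of \<open>(a + c) ^ 2\<close> and the carry
    term \<open>2 * s ^ 2\<close> add up to \<open>4 * (a * c)\<close>, which is 0.\<close>
  define s where "s = gr_sqrt n (a * c)"
  have s: "s ^ 2 = a * c" using x y teich_mult teich_power_q by (simp add: s_def gr_sqrt_square)
  have eq: "x + y = oplus n a c + 2 * (b + d - s)"
    by (simp add: x y oplus_def s_def algebra_simps)
  have sq: "2 * (b + d - s) ^ 2 = 2 * b ^ 2 + 2 * d ^ 2 + 2 * s ^ 2"
  proof -
    have "2 * (b + d - s) ^ 2 = 2 * b ^ 2 + 2 * d ^ 2 + 2 * s ^ 2 + 4 * (b * d - b * s - d * s)"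
      by (simp add: power2_eq_square algebra_simps)
    then show ?thesis by (simp add: four_eq_0)
  qed
  have "oplus n a c ^ 2 = (a + c) ^ 2" by (rule square_cong_Z) (rule two_mult_oplus)
  then have "frob n \<xi> (x + y) = (a + c) ^ 2 + (2 * b ^ 2 + 2 * d ^ 2 + 2 * s ^ 2)"
    unfolding eq using x y by (simp only: frob_eq'[OF oplus_in_teich] sq)
  also have "\<dots> = a ^ 2 + 2 * b ^ 2 + (c ^ 2 + 2 * d ^ 2) + 4 * (a * c)"
    by (simp add: s power2_sum algebra_simps)
  finally show ?thesis by (simp add: x y frob_eq' four_eq_0)
qed

lemma frob_zero: "frob n \<xi> 0 = 0"
  using frob_add[of 0 0] by simp

lemma frob_sum: "frob n \<xi> (\<Sum>i\<in>A. g i) = (\<Sum>i\<in>A. frob n \<xi> (g i))"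
  by (induction A rule: infinite_finite_induct) (simp_all add: frob_zero frob_add)

lemma funpow_frob_eq:
  assumes "a \<in> T" shows "(frob n \<xi> ^^ i) (a + 2 * b) = a ^ 2 ^ i + 2 * b ^ 2 ^ i"
  by (induction i) (use assms in \<open>simp_all add: frob_eq' teich_power power_mult[symmetric] mult.commute\<close>)

lemma funpow_frob_add: "(frob n \<xi> ^^ i) (x + y) = (frob n \<xi> ^^ i) x + (frob n \<xi> ^^ i) y"
  by (induction i) (simp_all add: frob_add)

lemma funpow_frob_n: "(frob n \<xi> ^^ n) x = x"
proof -
  obtain a b where "a \<in> T" "b \<in> T" "x = a + 2 * b" by (rule representation)
  then show ?thesis by (simp add: funpow_frob_eq teich_power_q)
qed

lemma trace_add: "gr_trace n \<xi> (x + y) = gr_trace n \<xi> x + gr_trace n \<xi> y"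
  by (simp add: gr_trace_def funpow_frob_add sum.distrib)

text \<open>Frobenius shifts the sum over the iterates cyclically, as its n-th iterate is the
  identity.\<close>

lemma frob_trace: "frob n \<xi> (gr_trace n \<xi> x) = gr_trace n \<xi> x"
proof -
  have "frob n \<xi> (gr_trace n \<xi> x) + x = (\<Sum>i<Suc n. (frob n \<xi> ^^ i) x)"
    unfolding sum.lessThan_Suc_shift by (simp add: gr_trace_def frob_sum)
  also have "\<dots> = gr_trace n \<xi> x + x" by (simp add: gr_trace_def funpow_frob_n)
  finally show ?thesis by simp
qed

lemma frob_fixed:
  assumes "frob n \<xi> x = x" obtains k :: nat where "k < 4" "of_nat k = x"
proof -
  \<comment> \<open>A nonzero Teichmueller element is no zero divisor, so t (t - 1) = 0 leaves only
    0 and 1. Both digits of a fixed element satisfy this.\<close>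
  have idem: "t = 0 \<or> t = 1" if "t \<in> T" "t ^ 2 = t" for t
  proof -
    have "t * (t - 1) = 0" using that by (simp add: power2_eq_square algebra_simps)
    moreover have "t \<noteq> 0 \<Longrightarrow> t \<notin> Z"
      using that(1) teich_inject[of t 0] zero_in_teich by (auto simp: Z_iff)
    ultimately show ?thesis using nonzero_divisor[of t "t - 1"] by auto
  qed
  obtain a b where ab: "a \<in> T" "b \<in> T" "x = a + 2 * b" by (rule representation)
  then have "a ^ 2 + 2 * b ^ 2 = a + 2 * b" using assms by (simp add: frob_eq)
  then have "a ^ 2 = a" "b ^ 2 = b" using representation_unique ab teich_power by metis+
  then have "(a = 0 \<or> a = 1) \<and> (b = 0 \<or> b = 1)" using idem ab by blast
  then show ?thesis using that[of 0] that[of 1] that[of 2] that[of 3] ab by auto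
qed

text \<open>Any natural number representing the trace may serve as exponent, since \<i> has order
  4.\<close>

lemma gr_char_eq:
  assumes "of_nat k = gr_trace n \<xi> (a * x)" shows "gr_char n \<xi> a x = \<i> ^ k"
proof -
  have "(THE l::nat. l < 4 \<and> of_nat l = gr_trace n \<xi> (a * x)) = k mod 4"
  proof (rule the_equality)
    have "of_nat k = (of_nat (4 * (k div 4) + k mod 4) :: 'r)" by simp
    then have k: "of_nat (k mod 4) = (of_nat k :: 'r)" by (simp only: of_nat_add of_nat_mult) simp
    then show "k mod 4 < 4 \<and> of_nat (k mod 4) = gr_trace n \<xi> (a * x)"
      using assms by simp
    fix l :: nat assume l: "l < 4 \<and> of_nat l = gr_trace n \<xi> (a * x)"
    \<comment> \<open>Adding the complement of \<open>k mod 4\<close> turns equality of residues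
      into divisibility by 4; the only multiple of 4 strictly between 0 and 8 is 4.\<close>
    then have "of_nat (l + (4 - k mod 4)) = (of_nat (k mod 4 + (4 - k mod 4)) :: 'r)"
      using k assms by (simp only: of_nat_add)
    then have "4 dvd l + (4 - k mod 4)" by (simp add: of_nat_eq_0_iff[symmetric])
    moreover have "0 < l + (4 - k mod 4)" "l + (4 - k mod 4) < 8"
      using l mod_less_divisor[of 4 k] by linarith+
    ultimately have "l + (4 - k mod 4) = 4" by (auto elim!: dvdE)
    then show "l = k mod 4" using mod_less_divisor[of 4 k] by linarith
  qed
  moreover have "\<i> ^ (k mod 4) = \<i> ^ k"
  proof -
    have "\<i> ^ k = \<i> ^ (4 * (k div 4) + k mod 4)" by simp
    also have "\<dots> = \<i> ^ (k mod 4)" unfolding power_add power_mult by simp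
    finally show ?thesis by simp
  qed
  ultimately show ?thesis by (simp add: gr_char_def)
qed

lemma trace_of_nat: obtains k :: nat where "k < 4" "of_nat k = gr_trace n \<xi> x"
  using frob_fixed[OF frob_trace] by blast

text \<open>If all these traces vanished, so would their sum with weights \<xi> to the power -k.
  Expanding the traces, orthogonality of the powers of \<xi> leaves only the term i = 0, which is 2
  (q - 1) and nonzero because q - 1 is odd.\<close>

lemma trace_nonzero: obtains k where "gr_trace n \<xi> (2 * \<xi> ^ k) \<noteq> 0"
proof (rule ccontr)
  assume "\<not> thesis"
  then have tr: "gr_trace n \<xi> (2 * \<xi> ^ k) = 0" for k using that by blast
  \<comment> \<open>The exponent \<open>q - 2\<close> plays the role of -1. For i > 0 the geometric
    sum is annihilated by \<open>\<xi> ^ m - 1\<close>, which is no zero divisor; for i = 0 every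
    term is 1.\<close>
  have sum_powers: "(\<Sum>k<q - 1. \<xi> ^ (k * (2 ^ i + (q - 2)))) = (if i = 0 then of_nat (q - 1) else 0)"
    if "i < n" for i
  proof -
    define m :: nat where "m = 2 ^ i - 1"
    have m: "2 ^ i + (q - 2) = m + (q - 1)" using q_ge_2 by (simp add: m_def)
    have "\<xi> ^ (k * (2 ^ i + (q - 2))) = (\<xi> ^ m) ^ k * (\<xi> ^ (q - 1)) ^ k" for k
      unfolding m power_mult[symmetric] power_add[symmetric] by (simp add: algebra_simps)
    then have eq: "(\<Sum>k<q - 1. \<xi> ^ (k * (2 ^ i + (q - 2)))) = (\<Sum>k<q - 1. (\<xi> ^ m) ^ k)"
      by (simp only: generator_power One_nat_def power_one mult_1_right)
    show ?thesis
    proof (cases "i = 0")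
      case True
      then show ?thesis unfolding eq by (simp add: m_def)
    next
      case False
      have "(2::nat) ^ i < 2 ^ n" using that by simp
      moreover have "(2::nat) ^ i \<ge> 2" using False by (cases i) auto
      ultimately have m: "0 < m" "m < q - 1" unfolding m_def by linarith+
      then have "\<xi> ^ m \<noteq> 1" by (rule generator_order)
      moreover have "\<xi> ^ m \<in> T" "1 \<in> T" using m power_q_in_teich[of 1] by (auto simp: teich_eq)
      ultimately have "\<xi> ^ m - 1 \<notin> Z" using teich_inject[of "\<xi> ^ m" 1] by (simp add: diff_in_Z)
      moreover have "(\<xi> ^ m - 1) * (\<Sum>k<q - 1. (\<xi> ^ m) ^ k) = 0"
      proof -
        have "(\<xi> ^ m) ^ (q - 1) = (\<xi> ^ (q - 1)) ^ m" by (simp add: power_mult[symmetric] mult.commute)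
        then show ?thesis using power_diff_1_eq[of "\<xi> ^ m" "q - 1"] by (simp add: generator_power)
      qed
      ultimately show ?thesis unfolding eq using False nonzero_divisor by simp
    qed
  qed
  have "0 = (\<Sum>k<q - 1. \<xi> ^ (k * (q - 2)) * gr_trace n \<xi> (2 * \<xi> ^ k))" by (simp add: tr)
  also have "\<dots> = (\<Sum>k<q - 1. \<Sum>i<n. 2 * \<xi> ^ (k * (2 ^ i + (q - 2))))"
  proof (rule sum.cong[OF refl])
    fix k
    have "gr_trace n \<xi> (2 * \<xi> ^ k) = (\<Sum>i<n. 2 * (\<xi> ^ k) ^ 2 ^ i)"
      using funpow_frob_eq[OF zero_in_teich, of _ "\<xi> ^ k"] by (simp add: gr_trace_def zero_power)
    then show "\<xi> ^ (k * (q - 2)) * gr_trace n \<xi> (2 * \<xi> ^ k) =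
        (\<Sum>i<n. 2 * \<xi> ^ (k * (2 ^ i + (q - 2))))"
      by (simp add: sum_distrib_left power_mult[symmetric] power_add distrib_left ac_simps)
  qed
  also have "\<dots> = (\<Sum>i<n. 2 * (\<Sum>k<q - 1. \<xi> ^ (k * (2 ^ i + (q - 2)))))"
    by (subst sum.swap) (simp add: sum_distrib_left)
  also have "\<dots> = (\<Sum>i<n. if i = 0 then 2 * of_nat (q - 1) else 0)"
    by (rule sum.cong[OF refl], subst sum_powers) simp_all
  also have "\<dots> = of_nat (2 * (q - 1))"
    using n_pos by (simp del: of_nat_diff)
  finally have "4 dvd 2 * (q - 1)" using of_nat_eq_0_iff by metis
  then have "even (q - 1)" by presburger
  moreover have "odd (q - 1)" using q_ge_2 n_pos by simp
  ultimately show False by simp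
qed

sublocale self_dual_pairing "gr_char n \<xi>"
proof
  fix a x y
  obtain k where k: "of_nat k = gr_trace n \<xi> (a * x)" using trace_of_nat by metis
  obtain l where l: "of_nat l = gr_trace n \<xi> (a * y)" using trace_of_nat by metis
  have "of_nat (k + l) = gr_trace n \<xi> (a * (x + y))" by (simp add: k l distrib_left trace_add)
  then show "gr_char n \<xi> a (x + y) = gr_char n \<xi> a x * gr_char n \<xi> a y"
    using gr_char_eq[OF k] gr_char_eq[OF l] gr_char_eq by (metis power_add)
  show "gr_char n \<xi> a x = gr_char n \<xi> x a" by (simp add: gr_char_def mult.commute)
  have "of_nat 0 = gr_trace n \<xi> (a * 0)" using trace_add[of 0 0] by simp
  then show "gr_char n \<xi> a 0 = 1" using gr_char_eq by fastforce
next
  fix a :: 'r assume "a \<noteq> 0"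
  obtain k where k: "gr_trace n \<xi> (2 * \<xi> ^ k) \<noteq> 0" by (rule trace_nonzero)
  have surj: "\<exists>y. u * y = x" if "u \<notin> Z" for u x :: 'r
  proof -
    have "inj ((*) u)" by (rule injI) (simp add: mult_left_inject[OF that])
    then show ?thesis using finite_UNIV_inj_surj[of "(*) u"] by (metis finite_class.finite_UNIV surjD)
  qed
  \<comment> \<open>Every nonzero a divides all multiples of 2: either a is a unit, or a = 2 u with
    u a unit. So a reaches the element of nonzero trace.\<close>
  have "\<exists>x. a * x = 2 * \<xi> ^ k"
  proof (cases "a \<in> Z")
    case True
    then obtain u where u: "a = 2 * u" by (rule ZE)
    then have "u \<notin> Z" using \<open>a \<noteq> 0\<close> Z_iff by blast
    then obtain y where "u * y = \<xi> ^ k" using surj by blast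
    then show ?thesis using u by (metis mult.assoc)
  qed (use surj in blast)
  then obtain x where x: "a * x = 2 * \<xi> ^ k" by blast
  obtain m where m: "m < 4" "of_nat m = gr_trace n \<xi> (a * x)" using trace_of_nat by metis
  then have "m \<noteq> 0" using k x by (metis of_nat_0)
  then have "m = 1 \<or> m = 2 \<or> m = 3" using m by auto
  then have "\<i> ^ m \<noteq> 1" by (auto simp: power3_eq_cube complex_eq_iff)
  then show "\<exists>x. gr_char n \<xi> a x \<noteq> 1" using gr_char_eq[OF m(2)] by metis
qed

section \<open>Character values and character sums\<close>

abbreviation ch :: "'r \<Rightarrow> 'r \<Rightarrow> complex" where "ch \<equiv> gr_char n \<xi>"

lemma ch_power_i: obtains k :: nat where "ch a x = \<i> ^ k"
  using trace_of_nat gr_char_eq by metis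

lemma ch_minus: "ch a (- x) = cnj (ch a x)"
proof -
  obtain k where k: "ch a x = \<i> ^ k" by (rule ch_power_i)
  have "\<i> ^ k * cnj (\<i> ^ k) = 1" by (simp add: power_mult_distrib[symmetric])
  then show ?thesis using pairing_minus[of a x] k by (metis mult.commute mult.left_commute mult_1_right)
qed

lemma ch_gaussian: "\<exists>x y. ch a g = complex_of_int x + \<i> * complex_of_int y"
proof -
  have *: "\<exists>x y. \<i> ^ k = complex_of_int x + \<i> * complex_of_int y" for k :: nat
  proof (induction k)
    case 0 show ?case by (rule exI[of _ 1], rule exI[of _ 0]) simp
  next
    case (Suc k)
    then obtain x y where "\<i> ^ k = complex_of_int x + \<i> * complex_of_int y" by blast
    then show ?case by (intro exI[of _ "- y"] exI[of _ x]) (simp add: algebra_simps)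
  qed
  obtain k where "ch a g = \<i> ^ k" by (rule ch_power_i)
  then show ?thesis using * by simp
qed

lemma char_sum_gaussian: "\<exists>x y. char_sum (ch a) A = complex_of_int x + \<i> * complex_of_int y"
proof -
  obtain x y where "ch a g = complex_of_int (x g) + \<i> * complex_of_int (y g)" for g
    using ch_gaussian[of a] by metis
  then show ?thesis
    by (intro exI[of _ "sum x A"] exI[of _ "sum y A"])
       (simp add: char_sum_def sum.distrib sum_distrib_left)
qed

lemma char_sum_uminus: "char_sum (ch a) (uminus ` A) = cnj (char_sum (ch a) A)"
  by (simp add: char_sum_def sum.reindex ch_minus)

text \<open>Products of two multiples of 2 vanish, so a in Z gives the trivial character on Z.
  Otherwise some \<open>ch a (2 * x)\<close> differs from 1, and translation by \<open>2 * x\<close>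
  forces the sum to be 0.\<close>

lemma char_sum_Z: "char_sum (ch a) Z = (if a \<in> Z then of_nat q else 0)"
proof (cases "a \<in> Z")
  case True
  have "ch a z = 1" if "z \<in> Z" for z
  proof -
    obtain u where "a = 2 * u" using True by (rule ZE)
    obtain v where "z = 2 * v" using \<open>z \<in> Z\<close> by (rule ZE)
    with \<open>a = 2 * u\<close> have "a * z = 4 * (u * v)" by (simp add: algebra_simps)
    then have "a * z = 0" by simp
    then show ?thesis using gr_char_eq[of 0 a z] trace_add[of 0 0] by simp
  qed
  then show ?thesis using True by (simp add: char_sum_def card_Z)
next
  case False
  then have "2 * a \<noteq> 0" by (simp add: Z_iff)
  then obtain x where "ch (2 * a) x \<noteq> 1" using pairing_nontrivial by blast
  moreover have "2 * a * x = a * (2 * x)" by (simp add: ac_simps)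
  ultimately have x: "ch a (2 * x) \<noteq> 1" by (simp add: gr_char_def)
  have "(\<Sum>z\<in>Z. ch a z) = (\<Sum>z\<in>Z. ch a (2 * x + z))"
    by (rule sum.reindex_bij_witness[of _ "\<lambda>z. 2 * x + z" "\<lambda>z. z - 2 * x"])
       (auto simp: Z_iff distrib_left right_diff_distrib)
  also have "\<dots> = ch a (2 * x) * (\<Sum>z\<in>Z. ch a z)" by (simp add: pairing_add sum_distrib_left)
  finally have "(ch a (2 * x) - 1) * (\<Sum>z\<in>Z. ch a z) = 0" by (simp add: algebra_simps)
  then show ?thesis using x False by (simp add: char_sum_def)
qed

lemma char_sum_UNIV: "char_sum (ch a) UNIV = of_bool (a = 0) * of_nat (q * q)"
  using pairing_sum[of a] by (simp add: char_sum_def card_ring)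

end

section \<open>Gaussian integers whose norm is a power of two\<close>

text \<open>Descent: for n \<ge> 2 the sum is divisible by 4, so x and y are both even, and halving
  them lowers n by 2.\<close>

lemma sum_two_squares_power_2:
  fixes x y :: int
  assumes "x ^ 2 + y ^ 2 = 2 ^ n"
  shows "if odd n then \<bar>x\<bar> = 2 ^ ((n - 1) div 2) \<and> \<bar>y\<bar> = 2 ^ ((n - 1) div 2)
         else \<bar>x\<bar> = 2 ^ (n div 2) \<and> y = 0 \<or> x = 0 \<and> \<bar>y\<bar> = 2 ^ (n div 2)"
  using assms
proof (induction n arbitrary: x y rule: nat_less_induct)
  case (1 n)
  have small: "\<bar>x\<bar> \<le> 1 \<and> \<bar>y\<bar> \<le> 1" if "x ^ 2 + y ^ 2 \<le> 2" for x y :: int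
  proof -
    have "x ^ 2 < 2 ^ 2" "y ^ 2 < 2 ^ 2"
      using that zero_le_power2[of x] zero_le_power2[of y] unfolding power2_eq_square by linarith+
    then have "\<bar>x\<bar> < 2" "\<bar>y\<bar> < 2" using abs_le_square_iff[of 2 x] abs_le_square_iff[of 2 y] by linarith+
    then show ?thesis by simp
  qed
  consider "n = 0" | "n = 1" | m where "n = m + 2" by (metis add_2_eq_Suc' not0_implies_Suc One_nat_def)
  then show ?case
  proof cases
    case 1
    then have "\<bar>x\<bar> \<le> 1 \<and> \<bar>y\<bar> \<le> 1" "x ^ 2 + y ^ 2 = 1" using "1.prems" small[of x y] by simp_all
    then have "(x = 0 \<or> x = 1 \<or> x = -1) \<and> (y = 0 \<or> y = 1 \<or> y = -1)" by linarith
    then show ?thesis using 1 \<open>x ^ 2 + y ^ 2 = 1\<close> by auto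
  next
    case 2
    then have "\<bar>x\<bar> \<le> 1 \<and> \<bar>y\<bar> \<le> 1" "x ^ 2 + y ^ 2 = 2" using "1.prems" small[of x y] by simp_all
    then have "(x = 0 \<or> x = 1 \<or> x = -1) \<and> (y = 0 \<or> y = 1 \<or> y = -1)" by linarith
    then show ?thesis using 2 \<open>x ^ 2 + y ^ 2 = 2\<close> by auto
  next
    case 3
    have eq: "x ^ 2 + y ^ 2 = 4 * 2 ^ m" using "1.prems" 3 by (simp add: power_add)
    have par: "even x \<and> even y"
    proof (rule ccontr)
      assume ne: "\<not> (even x \<and> even y)"
      have "even (x ^ 2 + y ^ 2)" by (simp add: eq)
      then have "odd x" "odd y" using ne by auto
      then obtain a b where "x = 2 * a + 1" "y = 2 * b + 1" by (meson oddE)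
      then have "x ^ 2 + y ^ 2 = 4 * (a ^ 2 + a + b ^ 2 + b) + 2"
        by (simp add: power2_eq_square algebra_simps)
      then show False using eq by presburger
    qed
    then obtain a b where ab: "x = 2 * a" "y = 2 * b" by (meson evenE)
    then have "a ^ 2 + b ^ 2 = 2 ^ m" using eq by (simp add: power_mult_distrib)
    then have IH: "if odd m then \<bar>a\<bar> = 2 ^ ((m - 1) div 2) \<and> \<bar>b\<bar> = 2 ^ ((m - 1) div 2)
         else \<bar>a\<bar> = 2 ^ (m div 2) \<and> b = 0 \<or> a = 0 \<and> \<bar>b\<bar> = 2 ^ (m div 2)"
      using "1.IH"[rule_format, of m a b] 3 by simp
    show ?thesis
    proof (cases "odd m")
      case True
      then have "(n - 1) div 2 = Suc ((m - 1) div 2)" using 3 by (auto elim!: oddE)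
      then show ?thesis using IH True 3 ab by (simp add: abs_mult)
    next
      case False
      then show ?thesis using IH 3 ab by (auto simp: abs_mult)
    qed
  qed
qed

section \<open>The difference set of a pseudo-planar function\<close>

locale planar_function = galois_ring n \<xi>
  for n :: nat and \<xi> :: "'r::{finite,comm_ring_1}" +
  fixes f :: "'r \<Rightarrow> 'r"
  assumes planar: "pseudo_planar n \<xi> f" and f_zero: "f 0 = 0"
begin

abbreviation D :: "'r set" where "D \<equiv> D_set n \<xi> f"
definition \<delta> :: "'r \<Rightarrow> 'r" where "\<delta> x = x + 2 * gr_sqrt n (f x)"

lemma D_eq: "D = \<delta> ` T"
  by (auto simp: D_set_def \<delta>_def)

lemma f_in_teich: "x \<in> T \<Longrightarrow> f x \<in> T"
  using planar by (auto simp: pseudo_planar_def)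

lemma two_mult_\<delta>: "2 * \<delta> x = 2 * x"
  by (simp add: \<delta>_def distrib_left)

lemma D_inject: "d \<in> D \<Longrightarrow> d' \<in> D \<Longrightarrow> 2 * d = 2 * d' \<longleftrightarrow> d = d'"
  by (auto simp: D_eq two_mult_\<delta> teich_inject)

lemma zero_in_D: "0 \<in> D"
proof -
  have "\<delta> 0 = 0" by (simp add: \<delta>_def f_zero gr_sqrt_def zero_power)
  then show ?thesis using zero_in_teich by (metis D_eq imageI)
qed

lemma card_D: "card D = q"
proof -
  have "inj_on \<delta> T" by (rule inj_onI) (metis two_mult_\<delta> teich_inject)
  then show ?thesis by (simp add: D_eq card_image card_teich)
qed

text \<open>Modulo Z the operation \<open>oplus\<close> is addition, and the square root, an iterate
  of squaring, is additive.\<close>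

lemma two_mult_gr_sqrt_oplus:
  "2 * gr_sqrt n (oplus n x y) = 2 * gr_sqrt n x + 2 * gr_sqrt n (y :: 'r)"
  using power_cong_Z[OF two_mult_oplus[of x y], of "2 ^ (n - 1)"]
  by (simp add: gr_sqrt_def two_mult_add_power)

lemma gr_sqrt_cong_Z:
  assumes "2 * gr_sqrt n u = 2 * gr_sqrt n v" "u \<in> T" "v \<in> T" shows "u = v"
  using square_cong_Z[OF assms(1)] assms by (simp add: gr_sqrt_square teich_power_q)

text \<open>Elements of \<open>D\<close> whose difference lies over \<open>\<epsilon>\<close> come from \<open>x \<oplus> \<epsilon>\<close> and \<open>x\<close>, and then
  the difference is \<open>\<epsilon>\<close> plus twice the square root of the permutation in the definition of
  a pseudo-planar function.\<close>

lemma D_difference_unique: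
  assumes D: "d1 \<in> D" "d2 \<in> D" "d3 \<in> D" "d4 \<in> D" and eq: "d1 - d2 = d3 - d4" and ne: "d1 \<noteq> d2"
  shows "d1 = d3 \<and> d2 = d4"
proof -
  obtain \<epsilon> where \<epsilon>: "\<epsilon> \<in> T" "2 * \<epsilon> = 2 * (d1 - d2)" by (rule teich_transversal)
  have \<epsilon>0: "\<epsilon> \<noteq> 0" using \<epsilon> ne D_inject[of d1 d2] D by (auto simp: right_diff_distrib)
  define g where "g x = oplus n (oplus n (f (oplus n x \<epsilon>)) (f x)) (\<epsilon> * x)" for x
  have "bij_betw g T T" using planar \<epsilon> \<epsilon>0 by (simp add: pseudo_planar_def g_def[abs_def])
  then have inj: "inj_on g T" by (rule bij_betw_imp_inj_on)
  have g_in: "g x \<in> T" if "x \<in> T" for x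
    using that \<epsilon> by (simp add: g_def oplus_in_teich f_in_teich teich_mult)
  have diff: "d - d' = \<epsilon> + 2 * gr_sqrt n (g x)"
    if "d \<in> D" "d' = \<delta> x" "x \<in> T" "2 * (d - d') = 2 * \<epsilon>" for d d' x
  proof -
    obtain y where y: "y \<in> T" "d = \<delta> y" using \<open>d \<in> D\<close> by (auto simp: D_eq)
    \<comment> \<open>The Teichmueller element y is determined by its class modulo Z, that of x +
      \<epsilon>.\<close>
    have "2 * y = 2 * oplus n x \<epsilon>"
      using that y by (simp add: two_mult_oplus right_diff_distrib distrib_left two_mult_\<delta> diff_eq_eq add.commute)
    then have yx: "y = oplus n x \<epsilon>" using y \<epsilon> that by (simp add: teich_inject oplus_in_teich)
    have "2 * gr_sqrt n (g x) = 2 * gr_sqrt n (f y) + 2 * gr_sqrt n (f x) + 2 * gr_sqrt n (\<epsilon> * x)"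
      by (simp add: g_def yx two_mult_gr_sqrt_oplus)
    moreover have "y = x + \<epsilon> + 2 * gr_sqrt n (\<epsilon> * x)" by (simp add: yx oplus_def mult.commute)
    \<comment> \<open>Signs do not matter in Z, so the difference of the two root terms is their
      sum, as in \<open>g\<close>.\<close>
    moreover have "2 * gr_sqrt n (f x) = - (2 * gr_sqrt n (f x))"
      using two_mult_minus[of "gr_sqrt n (f x)"] by simp
    ultimately show ?thesis using y that by (simp add: \<delta>_def algebra_simps)
  qed
  obtain x where x: "d2 = \<delta> x" "x \<in> T" using D by (auto simp: D_eq)
  obtain x' where x': "d4 = \<delta> x'" "x' \<in> T" using D by (auto simp: D_eq)
  have "d1 - d2 = \<epsilon> + 2 * gr_sqrt n (g x)"
    using D(1) x \<epsilon>(2)[symmetric] by (rule diff)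
  moreover have "d3 - d4 = \<epsilon> + 2 * gr_sqrt n (g x')"
    using D(3) x' \<epsilon>(2)[symmetric, unfolded eq] by (rule diff)
  ultimately have "2 * gr_sqrt n (g x) = 2 * gr_sqrt n (g x')" using eq by (metis add_left_cancel)
  then have "g x = g x'" by (rule gr_sqrt_cong_Z) (simp_all add: g_in x x')
  then have "x = x'" using inj x x' by (auto dest: inj_onD)
  then show ?thesis using x x' eq by simp
qed

section \<open>Differences and sums of distinct elements of D\<close>

definition offdiag :: "('r \<times> 'r) set" where "offdiag = {(d, d') \<in> D \<times> D. d \<noteq> d'}"

text \<open>Distinct elements of D are incongruent modulo Z, so their differences avoid Z.
  Injectivity is \<open>D_difference_unique\<close>, and both sides have q^2 - q elements.\<close>

lemma bij_betw_difference: "bij_betw (\<lambda>(d, d'). d - d') offdiag (- Z)"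
proof -
  have inj: "inj_on (\<lambda>(d, d'). d - d') offdiag"
  proof (rule inj_onI)
    fix p p' assume "p \<in> offdiag" "p' \<in> offdiag" "(\<lambda>(d, d'). d - d') p = (\<lambda>(d, d'). d - d') p'"
    then show "p = p'"
      using D_difference_unique[of "fst p" "snd p" "fst p'" "snd p'"] by (auto simp: offdiag_def)
  qed
  have sub: "(\<lambda>(d, d'). d - d') ` offdiag \<subseteq> - Z"
    by (auto simp: offdiag_def diff_in_Z D_inject)
  have "card offdiag = q * q - q"
  proof -
    have eq: "offdiag = D \<times> D - (\<lambda>d. (d, d)) ` D" by (auto simp: offdiag_def)
    have "card ((\<lambda>d. (d, d)) ` D) = q" by (simp add: card_image inj_on_def card_D)
    then show ?thesis unfolding eq by (subst card_Diff_subset) (auto simp: card_cartesian_product card_D)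
  qed
  moreover have "card (- Z) = q * q - q" by (simp add: Compl_eq_Diff_UNIV card_Diff_subset card_ring card_Z)
  ultimately have "(\<lambda>(d, d'). d - d') ` offdiag = - Z"
    using sub by (intro card_subset_eq) (simp_all add: card_image[OF inj])
  then show ?thesis using inj by (simp add: bij_betw_def)
qed

definition Y :: "'r set" where "Y = (\<lambda>(d, d'). d + d') ` offdiag"

lemma YI: "d \<in> D \<Longrightarrow> d' \<in> D \<Longrightarrow> d \<noteq> d' \<Longrightarrow> d + d' \<in> Y"
  by (force simp: Y_def offdiag_def)

lemma two_mult_D: "(\<lambda>d. 2 * d) ` D = Z"
proof (rule card_subset_eq)
  have "inj_on (\<lambda>d. 2 * d) D" by (rule inj_onI) (simp add: D_inject)
  then show "card ((\<lambda>d. 2 * d) ` D) = card Z" by (simp add: card_image card_D card_Z)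
qed (auto simp: two_mult_in_Z)

lemma sum_set_eq: "{d + d' | d d'. d \<in> D \<and> d' \<in> D} = Z \<union> Y"
proof
  show "{d + d' | d d'. d \<in> D \<and> d' \<in> D} \<subseteq> Z \<union> Y"
  proof clarify
    fix d d' assume "d \<in> D" "d' \<in> D" "d + d' \<notin> Y"
    then have "d = d'" using YI by blast
    then show "d + d' \<in> Z" using two_mult_in_Z[of d] by (simp only: mult_2)
  qed
  show "Z \<union> Y \<subseteq> {d + d' | d d'. d \<in> D \<and> d' \<in> D}"
    unfolding two_mult_D[symmetric] Y_def offdiag_def mult_2 by fastforce
qed

text \<open>Modulo Z the sum d + d' is the same as the difference d - d'.\<close>

lemma Y_disjoint_Z: "Y \<inter> Z = {}"
proof -
  have "d + d' \<notin> Z" if "d \<in> D" "d' \<in> D" "d \<noteq> d'" for d d'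
    using that diff_in_Z[of d "- d'"] two_mult_minus[of d'] D_inject[of d d'] by auto
  then show ?thesis by (auto simp: Y_def offdiag_def)
qed

text \<open>On the diagonal 2 d runs once through Z; off it, each element of Y comes from exactly
  two ordered pairs.\<close>

lemma char_sum_D_square:
  "char_sum (ch a) D ^ 2 = char_sum (ch a) Z + 2 * char_sum (ch a) Y"
proof -
  have split: "(\<Sum>p\<in>D \<times> D. h p) = (\<Sum>d\<in>D. h (d, d)) + (\<Sum>p\<in>offdiag. h p)" for h :: "'r \<times> 'r \<Rightarrow> complex"
  proof -
    have "D \<times> D = (\<lambda>d. (d, d)) ` D \<union> offdiag" by (auto simp: offdiag_def)
    moreover have "(\<lambda>d. (d, d)) ` D \<inter> offdiag = {}" by (auto simp: offdiag_def)
    ultimately have "(\<Sum>p\<in>D \<times> D. h p) = (\<Sum>p\<in>(\<lambda>d. (d, d)) ` D. h p) + (\<Sum>p\<in>offdiag. h p)"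
      by (simp add: sum.union_disjoint)
    then show ?thesis by (simp add: sum.reindex inj_on_def)
  qed
  have "char_sum (ch a) D ^ 2 = (\<Sum>(d, d')\<in>D \<times> D. ch a (d + d'))"
    by (simp add: power2_eq_square char_sum_def sum_product sum.cartesian_product pairing_add)
  also have "\<dots> = (\<Sum>d\<in>D. ch a (2 * d)) + (\<Sum>(d, d')\<in>offdiag. ch a (d + d'))"
    by (simp add: split mult_2[symmetric])
  also have "(\<Sum>d\<in>D. ch a (2 * d)) = char_sum (ch a) Z"
  proof -
    have "inj_on (\<lambda>d. 2 * d) D" by (rule inj_onI) (simp add: D_inject)
    then show ?thesis unfolding char_sum_def two_mult_D[symmetric] by (simp add: sum.reindex)
  qed
  also have "(\<Sum>(d, d')\<in>offdiag. ch a (d + d')) = 2 * char_sum (ch a) Y"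
  proof -
    have fib: "(\<Sum>(d, d')\<in>{p \<in> offdiag. (\<lambda>(d, d'). d + d') p = y}. ch a (d + d')) = 2 * ch a y" if "y \<in> Y" for y
    proof -
      obtain d0 d1 where d: "d0 \<in> D" "d1 \<in> D" "d0 \<noteq> d1" "y = d0 + d1"
        using \<open>y \<in> Y\<close> by (auto simp: Y_def offdiag_def)
      have "{p \<in> offdiag. (\<lambda>(d, d'). d + d') p = y} = {(d0, d1), (d1, d0)}"
      proof
        show "{(d0, d1), (d1, d0)} \<subseteq> {p \<in> offdiag. (\<lambda>(d, d'). d + d') p = y}"
          using d by (auto simp: offdiag_def add.commute)
        show "{p \<in> offdiag. (\<lambda>(d, d'). d + d') p = y} \<subseteq> {(d0, d1), (d1, d0)}"
        proof
          fix p assume "p \<in> {p \<in> offdiag. (\<lambda>(d, d'). d + d') p = y}"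
          then obtain d2 d3 where p: "p = (d2, d3)" "d2 \<in> D" "d3 \<in> D" "d2 + d3 = d0 + d1"
            using d by (auto simp: offdiag_def)
          \<comment> \<open>A second representation as a sum becomes an equality of differences,
            which forces the same or the swapped pair.\<close>
          then have "d2 - d0 = d1 - d3" by (simp add: algebra_simps)
          then have "d2 = d0 \<or> d2 = d1 \<and> d0 = d3" using D_difference_unique d p by metis
          then show "p \<in> {(d0, d1), (d1, d0)}" using p by auto
        qed
      qed
      then show ?thesis using d by (simp add: add.commute)
    qed
    have "(\<Sum>(d, d')\<in>offdiag. ch a (d + d')) =
        (\<Sum>y\<in>Y. \<Sum>(d, d')\<in>{p \<in> offdiag. (\<lambda>(d, d'). d + d') p = y}. ch a (d + d'))"
      unfolding Y_def by (rule sum.image_gen) simp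
    then show ?thesis by (simp add: fib char_sum_def sum_distrib_left)
  qed
  finally show ?thesis .
qed

text \<open>The diagonal contributes q, and the other differences run once through the complement of
  Z, where the character sums to 0.\<close>

lemma char_sum_D_norm:
  assumes "a \<notin> Z" shows "char_sum (ch a) D * cnj (char_sum (ch a) D) = of_nat q"
proof -
  have a0: "a \<noteq> 0" using assms two_mult_in_Z[of 0] by auto
  have D: "D \<times> D = (\<lambda>d. (d, d)) ` D \<union> offdiag" "(\<lambda>d. (d, d)) ` D \<inter> offdiag = {}"
    by (auto simp: offdiag_def)
  have "char_sum (ch a) D * cnj (char_sum (ch a) D) = (\<Sum>(d, d')\<in>D \<times> D. ch a (d - d'))"
    using pairing_add[of a _ "- _"]
    by (simp add: char_sum_def sum_product sum.cartesian_product ch_minus[symmetric])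
  also have "\<dots> = (\<Sum>(d, d')\<in>(\<lambda>d. (d, d)) ` D. ch a (d - d')) + (\<Sum>(d, d')\<in>offdiag. ch a (d - d'))"
    using D by (simp add: sum.union_disjoint)
  also have "(\<Sum>(d, d')\<in>(\<lambda>d. (d, d)) ` D. ch a (d - d')) = of_nat q"
    by (simp add: sum.reindex inj_on_def pairing_zero card_D)
  also have "(\<Sum>(d, d')\<in>offdiag. ch a (d - d')) = (\<Sum>r\<in>- Z. ch a r)"
    using sum.reindex_bij_betw[OF bij_betw_difference, of "ch a"] by (simp add: case_prod_unfold)
  also have "\<dots> = char_sum (ch a) UNIV - char_sum (ch a) Z"
    by (simp add: char_sum_def Compl_eq_Diff_UNIV sum_diff)
  also have "\<dots> = 0" using assms a0 by (simp add: char_sum_UNIV char_sum_Z)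
  finally show ?thesis by simp
qed

text \<open>Every ring element is d + z in exactly one way, as D is a transversal of Z.\<close>

lemma char_sum_D_Z: "char_sum (ch a) D * char_sum (ch a) Z = char_sum (ch a) UNIV"
proof -
  have inj: "inj_on (\<lambda>(d, z). d + z) (D \<times> Z)"
  proof (rule inj_onI, clarify)
    fix d z d' z' assume *: "d \<in> D" "d' \<in> D" "z \<in> Z" "z' \<in> Z" "d + z = d' + z'"
    then have "2 * d + 2 * z = 2 * d' + 2 * z'" by (simp only: distrib_left[symmetric])
    then have "2 * d = 2 * d'" using * by (simp add: Z_iff)
    then show "d = d' \<and> z = z'" using * D_inject by simp
  qed
  have "card ((\<lambda>(d, z). d + z) ` (D \<times> Z)) = CARD('r)"
    by (simp add: card_image[OF inj] card_cartesian_product card_D card_Z card_ring)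
  then have "bij_betw (\<lambda>(d, z). d + z) (D \<times> Z) UNIV"
    using inj card_subset_eq[of "UNIV :: 'r set"] by (simp add: bij_betw_def)
  then have "(\<Sum>p\<in>D \<times> Z. ch a ((\<lambda>(d, z). d + z) p)) = (\<Sum>x\<in>UNIV. ch a x)"
    by (rule sum.reindex_bij_betw)
  then show ?thesis
    by (simp add: char_sum_def sum_product sum.cartesian_product case_prod_unfold pairing_add)
qed

lemma char_sum_D_in_Z:
  assumes "a \<in> Z" shows "char_sum (ch a) D = (if a = 0 then of_nat q else 0)"
  using char_sum_D_Z[of a] assms by (auto simp: char_sum_Z char_sum_UNIV)

lemma char_sum_D_notin_Z:
  assumes "a \<notin> Z" obtains j where "j \<in> {2..5}" "char_sum (ch a) D = v_value n j"
proof -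
  obtain x y where xy: "char_sum (ch a) D = complex_of_int x + \<i> * complex_of_int y"
    using char_sum_gaussian by blast
  have "complex_of_int (x ^ 2 + y ^ 2) = of_int (2 ^ n)"
    using char_sum_D_norm[OF assms] by (simp add: xy algebra_simps power2_eq_square complex_eq_iff)
  then have "x ^ 2 + y ^ 2 = 2 ^ n" by (simp only: of_int_eq_iff)
  note sq = sum_two_squares_power_2[OF this]
  have "\<exists>j\<in>{2,3,4,5}. char_sum (ch a) D = v_value n j"
  proof (cases "odd n")
    case True
    define c :: int where "c = 2 ^ ((n - 1) div 2)"
    have c: "(2::complex) ^ ((n - 1) div 2) = of_int c" by (simp add: c_def)
    have "(x = c \<or> x = - c) \<and> (y = c \<or> y = - c)" using sq True unfolding c_def by (simp add: abs_eq_iff')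
    then show ?thesis unfolding v_value_def c using True by (auto simp: xy Let_def)
  next
    case False
    define c :: int where "c = 2 ^ (n div 2)"
    have c: "(2::complex) ^ (n div 2) = of_int c" by (simp add: c_def)
    have "(x = c \<or> x = - c) \<and> y = 0 \<or> x = 0 \<and> (y = c \<or> y = - c)" using sq False unfolding c_def by (simp add: abs_eq_iff')
    then show ?thesis unfolding v_value_def c using False by (auto simp: xy Let_def)
  qed
  then obtain j where "j \<in> {2,3,4,5}" "char_sum (ch a) D = v_value n j" by blast
  then show ?thesis by (intro that[of j]) auto
qed

end

section \<open>The eigenmatrices are mutually inverse up to scaling\<close>

lemma atMost_5: "{0..5::nat} = {0, 1, 2, 3, 4, 5}"
  by auto

lemma P_odd_Q_odd:
  assumes "j \<in> {0..5}" "k \<in> {0..5}" "1 - b * \<i> \<noteq> 0"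
  shows "(\<Sum>i\<in>{0..5}. P_odd b j i * Q_odd b i k) = of_bool (j = k) * (4 * b ^ 4)"
proof -
  \<comment> \<open>Clears the denominator of the last entry of Q by b^2 + 1 = (1 - b \<i>) (1 + b
    \<i>).\<close>
  have "b * (b ^ 2 + 1) / (2 * (1 - b * \<i>)) = b / 2 * (1 + b * \<i>)"
    using assms(3) by (simp add: divide_simps) (simp add: algebra_simps power2_eq_square)
  note Q = Q_odd_def[of b, unfolded this]
  show ?thesis
    using assms(1,2) unfolding atMost_5 P_odd_def Q
    by (elim insertE emptyE; simp add: field_simps eval_nat_numeral)
qed

lemma P_even_Q_even:
  assumes "j \<in> {0..5}" "k \<in> {0..5}"
  shows "(\<Sum>i\<in>{0..5}. P_even b j i * Q_even b i k) = of_bool (j = k) * (16 * b ^ 4)"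
  using assms unfolding atMost_5 P_even_def Q_even_def
  by (elim insertE emptyE; simp add: field_simps eval_nat_numeral)

text \<open>Factoring the entries shows where they vanish; the excluded b = 1 is the case n = 1,
  where some entries are indeed 0.\<close>

lemma P_odd_row_0:
  assumes "b \<noteq> 0" "b ^ 2 \<noteq> 1" "2 * b ^ 2 \<noteq> 1" "i \<in> {0..5}"
  shows "P_odd b 0 i \<noteq> 0" "Q_odd b 0 i \<noteq> 0"
proof -
  have b: "b + 1 \<noteq> 0" "b - 1 \<noteq> 0" "b ^ 2 - 1 \<noteq> 0" "2 * b ^ 2 - 1 \<noteq> 0"
    using assms by (auto simp: add_eq_0_iff2)
  have "2 * b ^ 4 - 3 * b ^ 2 + 1 = (2 * b ^ 2 - 1) * (b ^ 2 - 1)"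
    "b / 2 * (2 * b ^ 3 + 2 * b ^ 2 - b - 1) = b / 2 * ((2 * b ^ 2 - 1) * (b + 1))"
    "b / 2 * (2 * b ^ 3 - 2 * b ^ 2 - b + 1) = b / 2 * ((2 * b ^ 2 - 1) * (b - 1))"
    by algebra+
  note eqs = P_odd_def[of b, unfolded this] Q_odd_def[of b, unfolded this]
  show "P_odd b 0 i \<noteq> 0" "Q_odd b 0 i \<noteq> 0"
    using assms(4) unfolding atMost_5 eqs
    by (elim insertE emptyE; simp only:; use assms b in simp)+
qed

lemma P_even_row_0:
  assumes "b \<noteq> 0" "b ^ 2 \<noteq> 1" "4 * b ^ 2 \<noteq> 1" "i \<in> {0..5}"
  shows "P_even b 0 i \<noteq> 0" "Q_even b 0 i \<noteq> 0"
proof -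
  have b: "b + 1 \<noteq> 0" "b - 1 \<noteq> 0" "b ^ 2 - 1 \<noteq> 0" "4 * b ^ 2 - 1 \<noteq> 0"
    using assms by (auto simp: add_eq_0_iff2)
  have "8 * b ^ 4 - 10 * b ^ 2 + 2 = 2 * ((4 * b ^ 2 - 1) * (b ^ 2 - 1))"
    "8 * b ^ 4 - 2 * b ^ 2 = 2 * (b ^ 2 * (4 * b ^ 2 - 1))"
    "b * (4 * b ^ 3 + 4 * b ^ 2 - b - 1) = b * ((4 * b ^ 2 - 1) * (b + 1))"
    "b * (4 * b ^ 3 - 4 * b ^ 2 - b + 1) = b * ((4 * b ^ 2 - 1) * (b - 1))"
    by algebra+
  note eqs = P_even_def[of b, unfolded this] Q_even_def[of b, unfolded this]
  show "P_even b 0 i \<noteq> 0" "Q_even b 0 i \<noteq> 0"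
    using assms(4) unfolding atMost_5 eqs
    by (elim insertE emptyE; simp only:; use assms b in simp)+
qed

lemma eigenmatrix_row_0:
  assumes "n \<ge> 3" "i \<in> {0..5}"
  shows "P_matrix n 0 i \<noteq> 0" "Q_matrix n 0 i \<noteq> 0"
proof -
  define k where "k = (if odd n then (n - 1) div 2 else (n - 2) div 2)"
  define b :: complex where "b = 2 ^ k"
  have "k > 0" using assms(1) unfolding k_def by presburger
  then obtain l where l: "k = Suc l" using gr0_implies_Suc by blast
  \<comment> \<open>As k > 0, the number b^2 and its multiples by 2 and 4 are even natural numbers,
    hence different from 1.\<close>
  have "b ^ 2 = (2 ^ 2) ^ k" unfolding b_def by (simp only: power_mult[symmetric] mult.commute)
  then have "b ^ 2 = of_nat (4 * 4 ^ l)" by (simp add: l)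
  then have "b ^ 2 = of_nat (4 * 4 ^ l)" "2 * b ^ 2 = of_nat (2 * (4 * 4 ^ l))"
    "4 * b ^ 2 = of_nat (4 * (4 * 4 ^ l))" by simp_all
  moreover have "(of_nat m :: complex) \<noteq> 1" if "even m" for m
    using that by (metis odd_one of_nat_1 of_nat_eq_iff)
  ultimately have b: "b ^ 2 \<noteq> 1" "2 * b ^ 2 \<noteq> 1" "4 * b ^ 2 \<noteq> 1"
    by (metis dvd_triv_left even_mult_iff even_numeral)+
  have b0: "b \<noteq> 0" by (simp add: b_def)
  show "P_matrix n 0 i \<noteq> 0" "Q_matrix n 0 i \<noteq> 0"
    using P_odd_row_0[OF b0 b(1,2) assms(2)] P_even_row_0[OF b0 b(1,3) assms(2)]
    by (auto simp: P_matrix_def Q_matrix_def b_def k_def)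
qed

section \<open>The character table\<close>

context planar_function
begin

section \<open>The six classes and their negatives\<close>

abbreviation S :: "nat \<Rightarrow> 'r set" where "S \<equiv> S_class n \<xi> f"

definition D1 :: "'r set" where "D1 = D - {0}"
definition D2 :: "'r set" where "D2 = uminus ` D1"

lemma zero_in_Z: "0 \<in> Z"
  using two_mult_in_Z[of 0] by simp

lemma S_class_eq:
  "S 0 = {0}" "S 1 = D1" "S 2 = D2" "S 3 = Z - {0}"
  "S 4 = Y - (D1 \<union> D2)" "S 5 = - (Z \<union> Y \<union> D1 \<union> D2)"
proof -
  have neg: "{- x | x. x \<in> A} = uminus ` A" for A :: "'r set" by auto
  show eq: "S 0 = {0}" "S 1 = D1" "S 2 = D2" "S 3 = Z - {0}"
    by (simp_all add: S_class_def Let_def Z_def D1_def D2_def neg)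
  have "S 4 = (Z \<union> Y) - ({0} \<union> D1 \<union> D2 \<union> (Z - {0}))"
    by (simp add: S_class_def Let_def Z_def[symmetric] D1_def D2_def neg sum_set_eq)
  then show eq4: "S 4 = Y - (D1 \<union> D2)"
    using Y_disjoint_Z zero_in_Z by blast
  have "S 5 = UNIV - (S 0 \<union> S 1 \<union> S 2 \<union> S 3 \<union> S 4)"
    by (simp add: S_class_def Let_def)
  then show "S 5 = - (Z \<union> Y \<union> D1 \<union> D2)"
    using zero_in_Z unfolding eq eq4 by blast
qed

lemma D1_subset_Y: "D1 \<subseteq> Y"
  using YI[OF _ zero_in_D] by (auto simp: D1_def)

text \<open>If d and -d both lie in D they coincide, being congruent modulo Z; then 2 d = 0, so d =
  0.\<close>

lemma D1_D2_disjoint: "D1 \<inter> D2 = {}"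
proof -
  have "d = 0" if "d \<in> D" "- d \<in> D" for d
  proof -
    have "- d = d" using that D_inject two_mult_minus[of d] by metis
    then have "2 * d = 2 * 0" using two_mult_minus[of d] by (metis add.right_inverse mult_2 mult_zero_right)
    then show ?thesis using that D_inject zero_in_D by metis
  qed
  then show ?thesis by (auto simp: D1_def D2_def)
qed

lemma D2_disjoint_Z: "D2 \<inter> Z = {}"
proof -
  have "- d \<notin> Z" if "d \<in> D1" for d
  proof -
    have "d \<notin> Z" using D1_subset_Y Y_disjoint_Z that by blast
    then show ?thesis using two_mult_minus[of d] by (simp add: Z_iff)
  qed
  then show ?thesis by (auto simp: D2_def)
qed

abbreviation u :: "'r \<Rightarrow> complex" where "u a \<equiv> char_sum (ch a) D"

lemma D_value_cases:
  obtains "a = 0" "u a = of_nat q" | "a \<in> Z" "a \<noteq> 0" "u a = 0"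
  | j where "a \<notin> Z" "j \<in> {2..5}" "u a = v_value n j"
proof (cases "a \<in> Z")
  case True
  then show ?thesis using that(1,2) char_sum_D_in_Z[of a] by (cases "a = 0") simp_all
next
  case False
  then obtain j where "j \<in> {2..5}" "u a = v_value n j" by (rule char_sum_D_notin_Z)
  then show ?thesis using that(3) False by blast
qed

text \<open>For even n the values are real or purely imaginary; for odd n both coordinates have the
  same absolute value, so the square is purely imaginary.\<close>

lemma v_value_square:
  assumes "j \<in> {2..5}"
  shows "even n \<Longrightarrow> cnj (v_value n j) ^ 2 = v_value n j ^ 2"
    and "odd n \<Longrightarrow> cnj (v_value n j) ^ 2 = - (v_value n j ^ 2)"
proof -
  have "{2..5::nat} = {2, 3, 4, 5}" by auto
  then have j: "j \<in> {2, 3, 4, 5}" using assms by simp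
  show "even n \<Longrightarrow> cnj (v_value n j) ^ 2 = v_value n j ^ 2"
    using j by (auto simp: v_value_def Let_def power_mult_distrib)
  show "odd n \<Longrightarrow> cnj (v_value n j) ^ 2 = - (v_value n j ^ 2)"
    using j by (auto simp: v_value_def Let_def power2_eq_square algebra_simps)
qed

lemma char_sum_Y: "char_sum (ch a) Y = (u a ^ 2 - char_sum (ch a) Z) / 2"
  using char_sum_D_square[of a] by simp

text \<open>The transform of -Y is the conjugate of that of Y, which is real here.\<close>

lemma uminus_Y_even:
  assumes "even n" shows "uminus ` Y = Y"
proof -
  have "(\<lambda>x. of_bool (x \<in> uminus ` Y)) = (\<lambda>x. of_bool (x \<in> Y) :: complex)"
  proof (rule fourier_inject, rule ext)
    fix a
    have "cnj (u a) ^ 2 = u a ^ 2"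
      by (cases a rule: D_value_cases) (simp_all add: v_value_square assms)
    then show "fourier (\<lambda>x. of_bool (x \<in> uminus ` Y)) a = fourier (\<lambda>x. of_bool (x \<in> Y)) a"
      by (simp add: fourier_indicator char_sum_uminus char_sum_Y char_sum_Z)
  qed
  then show ?thesis by (auto simp: fun_eq_iff of_bool_eq_iff simp del: image_iff)
qed

text \<open>The indicators of -Y, Y and Z add up to a function whose transform is the real part of
  \<open>u a ^ 2\<close>. This vanishes except at a = 0, just as the transform of the constant 1
  does.\<close>

lemma uminus_Y_odd:
  assumes "odd n" shows "uminus ` Y = - (Z \<union> Y)"
proof -
  let ?g = "\<lambda>x. of_bool (x \<in> uminus ` Y) + of_bool (x \<in> Y) + of_bool (x \<in> Z) :: complex"
  have "?g = (\<lambda>x. of_bool (x \<in> UNIV))"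
  proof (rule fourier_inject, rule ext)
    fix a
    have "fourier ?g a = char_sum (ch a) (uminus ` Y) + char_sum (ch a) Y + char_sum (ch a) Z"
      by (simp only: fourier_indicator[symmetric]) (simp add: fourier_def distrib_right sum.distrib)
    also have "\<dots> = (cnj (u a) ^ 2 + u a ^ 2) / 2"
      by (simp add: char_sum_uminus char_sum_Y char_sum_Z field_simps)
    also have "\<dots> = char_sum (ch a) UNIV"
      by (cases a rule: D_value_cases)
         (use zero_in_Z in \<open>auto simp: v_value_square assms char_sum_UNIV power2_eq_square[of "2 ^ n"]\<close>)
    finally show "fourier ?g a = fourier (\<lambda>x. of_bool (x \<in> UNIV)) a" by (simp only: fourier_indicator)
  qed
  then have "?g x = 1" for x by (simp add: fun_eq_iff)
  then have "x \<in> uminus ` Y \<longleftrightarrow> x \<notin> Z \<union> Y" for x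
    using Y_disjoint_Z by (fastforce simp del: image_iff split: if_splits simp: of_bool_def dest: spec[of _ x])
  then show ?thesis by blast
qed

lemma D2_Y: "if even n then D2 \<subseteq> Y else D2 \<inter> Y = {}"
proof -
  have "D2 \<subseteq> uminus ` Y" using D1_subset_Y by (auto simp: D2_def)
  then show ?thesis using uminus_Y_even uminus_Y_odd by auto
qed

lemma in_S_iff:
  assumes "i \<in> {0..5}"
  shows "x \<in> S i \<longleftrightarrow> i = (if x = 0 then 0 else if x \<in> D1 then 1 else if x \<in> D2 then 2
    else if x \<in> Z then 3 else if x \<in> Y then 4 else 5)"
proof -
  have f: "x = 0 \<longrightarrow> x \<in> Z" "x \<in> D1 \<longrightarrow> x \<in> Y" "x \<in> D1 \<longrightarrow> x \<notin> D2"
    "x \<in> D2 \<longrightarrow> x \<notin> Z" "x \<in> Y \<longrightarrow> x \<notin> Z"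
    using zero_in_Z subsetD[OF D1_subset_Y] disjoint_iff[THEN iffD1, OF D1_D2_disjoint]
      disjoint_iff[THEN iffD1, OF D2_disjoint_Z] disjoint_iff[THEN iffD1, OF Y_disjoint_Z]
    by metis+
  have "i = 0 \<or> i = 1 \<or> i = 2 \<or> i = 3 \<or> i = 4 \<or> i = 5"
    using assms by auto
  then show ?thesis
    by (elim disjE; simp only: S_class_eq; use f in \<open>auto split: if_splits\<close>)
qed

lemma S_disjoint_family: "disjoint_family_on S {0..5}"
proof (unfold disjoint_family_on_def, intro ballI impI equals0I)
  fix i j x assume "i \<in> {0..5}" "j \<in> {0..5}" "i \<noteq> j" "x \<in> S i \<inter> S j"
  then show False using in_S_iff[of i x] in_S_iff[of j x] by simp
qed

lemma S_Union: "(\<Union>i\<in>{0..5}. S i) = UNIV"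
proof -
  have "\<exists>i\<in>{0..5}. x \<in> S i" for x
  proof -
    define i :: nat where "i = (if x = 0 then 0 else if x \<in> D1 then 1 else if x \<in> D2 then 2
      else if x \<in> Z then 3 else if x \<in> Y then 4 else 5)"
    have "i \<in> {0..5}" by (simp add: i_def)
    then show ?thesis using in_S_iff[of i x] i_def by blast
  qed
  then show ?thesis by blast
qed

lemma uminus_S: "i \<in> {0..5} \<Longrightarrow> \<exists>i'\<in>{0..5}. uminus ` S i = S i'"
proof -
  have invol: "uminus ` uminus ` A = A" for A :: "'r set" by (simp add: image_image)
  have Z: "uminus ` Z = Z"
  proof -
    have "uminus ` Z \<subseteq> Z" using two_mult_minus by (auto simp: Z_iff)
    then show ?thesis using invol by blast
  qed
  have compl: "uminus ` (- A) = - uminus ` A" for A :: "'r set"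
    by (rule bij_image_Compl_eq) (rule bij_uminus)
  have inj: "inj (uminus :: 'r \<Rightarrow> 'r)" by (rule inj_uminus)
  have D12: "uminus ` D1 = D2" "uminus ` D2 = D1" by (simp_all add: D2_def invol)
  have S4: "uminus ` S 4 = uminus ` Y - (D1 \<union> D2)"
    unfolding S_class_eq image_set_diff[OF inj] image_Un D12 by blast
  have S5: "uminus ` S 5 = - (Z \<union> uminus ` Y \<union> D1 \<union> D2)"
    unfolding S_class_eq compl image_Un D12 Z by blast
  \<comment> \<open>S 4 and S 5 are symmetric for even n and exchanged for odd n.\<close>
  have S4': "uminus ` S 4 = S (if even n then 4 else 5)"
    using S4 uminus_Y_even uminus_Y_odd by (auto simp: S_class_eq)
  moreover have "uminus ` S 5 = S (if even n then 5 else 4)"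
  proof (cases "even n")
    case True
    then show ?thesis using S5 uminus_Y_even by (auto simp: S_class_eq)
  next
    case False
    then have "uminus ` S 4 = S 5" using S4' by simp
    then show ?thesis using False invol by metis
  qed
  moreover have "uminus ` S 0 = S 0" "uminus ` S 1 = S 2" "uminus ` S 2 = S 1" "uminus ` S 3 = S 3"
    unfolding S_class_eq by (simp_all add: D12 image_set_diff[OF inj] Z)
  ultimately show "\<exists>i'\<in>{0..5}. uminus ` S i = S i'" if "i \<in> {0..5}"
    using that S4' unfolding atMost_5 by (elim insertE emptyE) (simp_all split: if_splits)
qed

section \<open>The dual classes and the entries of P\<close>

definition D_value :: "nat \<Rightarrow> complex"
  where "D_value j = (if j = 0 then of_nat q else if j = 1 then 0 else v_value n j)"

text \<open>The class E_j as a set of parameters a. Since 0 lies in D but not in S 1, the -1 of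
  \<open>E_class\<close> disappears.\<close>

definition dual_class :: "nat \<Rightarrow> 'r set" where "dual_class j = {a. u a = D_value j}"

lemma D_value_inj: "inj_on D_value {0..5}"
proof (cases "odd n")
  case True
  define c :: real where "c = 2 ^ ((n - 1) div 2)"
  have "c > 0" by (simp add: c_def)
  moreover have "(2::complex) ^ ((n - 1) div 2) = of_real c" by (simp add: c_def)
  ultimately show ?thesis
    unfolding inj_on_def atMost_5 using True
    by (auto simp: D_value_def v_value_def Let_def complex_eq_iff)
next
  case False
  define c :: real where "c = 2 ^ (n div 2)"
  have c: "(2::complex) ^ (n div 2) = of_real c" by (simp add: c_def)
  obtain m where m: "n = 2 * m" using False by (auto elim: evenE)
  \<comment> \<open>This bound separates the principal value q = c^2 from the value c.\<close>
  then have "c \<ge> 2" using n_pos by (cases m) (auto simp: c_def)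
  have q: "(2::complex) ^ n = of_real (c * c)"
    by (simp add: c_def m power_add[symmetric] mult_2[symmetric])
  have "c > 0" "c * c > 0" using \<open>c \<ge> 2\<close> by auto
  then have "c * c \<noteq> - c" "- c \<noteq> c * c" by linarith+
  moreover have "c * c \<noteq> c" "c > 0" using \<open>c \<ge> 2\<close> by auto
  ultimately show ?thesis
    unfolding inj_on_def atMost_5 using False
    by (auto simp: D_value_def v_value_def Let_def complex_eq_iff c q)
qed

lemma dual_class_disjoint: "disjoint_family_on dual_class {0..5}"
  using D_value_inj by (auto simp: disjoint_family_on_def dual_class_def inj_on_def)

lemma dual_class_Union: "(\<Union>j\<in>{0..5}. dual_class j) = UNIV"
proof -
  have "\<exists>j\<in>{0..5}. u a = D_value j" for a
  proof (cases a rule: D_value_cases)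
    case 1 then show ?thesis by (intro bexI[of _ 0]) (auto simp: D_value_def)
  next
    case 2 then show ?thesis by (intro bexI[of _ 1]) (auto simp: D_value_def)
  next
    case (3 j) then show ?thesis by (intro bexI[of _ j]) (auto simp: D_value_def)
  qed
  then show ?thesis by (auto simp: dual_class_def)
qed

lemma dual_classD:
  assumes "a \<in> dual_class j" "j \<in> {0..5}"
  shows "a = 0 \<longleftrightarrow> j = 0" "a \<in> Z \<longleftrightarrow> j \<le> 1"
proof -
  have u: "u a = D_value j" using assms by (simp add: dual_class_def)
  have eqI: "j = k" if "u a = D_value k" "k \<in> {0..5}" for k
    using D_value_inj that u assms by (metis inj_onD)
  have "(a = 0 \<longleftrightarrow> j = 0) \<and> (a \<in> Z \<longleftrightarrow> j \<le> 1)"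
  proof (cases a rule: D_value_cases)
    case 1 then show ?thesis using eqI[of 0] zero_in_Z by (simp add: D_value_def)
  next
    case 2 then show ?thesis using eqI[of 1] by (simp add: D_value_def)
  next
    case (3 k) then show ?thesis using eqI[of k] zero_in_Z by (auto simp: D_value_def)
  qed
  then show "a = 0 \<longleftrightarrow> j = 0" "a \<in> Z \<longleftrightarrow> j \<le> 1" by auto
qed

lemma dual_class_zero: "dual_class 0 = {0}"
proof -
  have "0 \<in> dual_class 0" using char_sum_D_in_Z[of 0] zero_in_Z by (simp add: dual_class_def D_value_def)
  then show ?thesis using dual_classD(1)[of _ 0] by auto
qed

text \<open>D1 always lies in Y, whereas D2 lies in Y for even n and is disjoint from it for odd n;
  hence the case distinction for S 4. S 5 follows from the total over R.\<close>

lemma char_sum_S_class: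
  "char_sum (ch a) (S 0) = 1"
  "char_sum (ch a) (S 1) = u a - 1"
  "char_sum (ch a) (S 2) = cnj (u a) - 1"
  "char_sum (ch a) (S 3) = char_sum (ch a) Z - 1"
  "char_sum (ch a) (S 4) = char_sum (ch a) Y - (u a - 1) - (if even n then cnj (u a) - 1 else 0)"
  "char_sum (ch a) (S 5) = char_sum (ch a) UNIV - char_sum (ch a) Z - (u a - 1) - (cnj (u a) - 1) -
     char_sum (ch a) (S 4)"
proof -
  have del0: "char_sum (ch a) (A - {0}) = char_sum (ch a) A - 1" if "0 \<in> A" for A
    using that by (simp add: char_sum_def sum_diff1 pairing_zero)
  show S0: "char_sum (ch a) (S 0) = 1" by (simp add: S_class_eq char_sum_def pairing_zero)
  have D1: "char_sum (ch a) D1 = u a - 1" by (simp add: D1_def del0 zero_in_D)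
  have D2: "char_sum (ch a) D2 = cnj (u a) - 1" by (simp add: D2_def char_sum_uminus D1)
  show S1: "char_sum (ch a) (S 1) = u a - 1" and S2: "char_sum (ch a) (S 2) = cnj (u a) - 1"
    unfolding S_class_eq by (rule D1 D2)+
  show S3: "char_sum (ch a) (S 3) = char_sum (ch a) Z - 1" by (simp add: S_class_eq del0 zero_in_Z)
  have D12: "char_sum (ch a) (D1 \<union> D2) = (u a - 1) + (cnj (u a) - 1)"
    using D1_D2_disjoint D1 D2 by (simp add: char_sum_def sum.union_disjoint)
  show "char_sum (ch a) (S 4) = char_sum (ch a) Y - (u a - 1) - (if even n then cnj (u a) - 1 else 0)"
  proof (cases "even n")
    case True
    then have "D1 \<union> D2 \<subseteq> Y" using D2_Y D1_subset_Y by simp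
    then show ?thesis using True D12 by (simp add: S_class_eq char_sum_def sum_diff)
  next
    case False
    then have "S 4 = Y - D1" using D2_Y by (auto simp: S_class_eq)
    then show ?thesis using False D1 D1_subset_Y by (simp add: char_sum_def sum_diff)
  qed
  have "char_sum (ch a) UNIV = (\<Sum>i\<in>{0..5}. char_sum (ch a) (S i))"
    unfolding S_Union[symmetric] char_sum_def
    using S_disjoint_family by (intro sum.UNION_disjoint) (auto simp: disjoint_family_on_def)
  then show "char_sum (ch a) (S 5) = char_sum (ch a) UNIV - char_sum (ch a) Z - (u a - 1) - (cnj (u a) - 1) -
     char_sum (ch a) (S 4)"
    using S1 by (simp add: atMost_5 S0 S2 S3)
qed

lemma char_table:
  assumes "i \<in> {0..5}" "j \<in> {0..5}" "a \<in> dual_class j"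
  shows "char_sum (ch a) (S i) = P_matrix n j i"
proof -
  \<comment> \<open>The sums over D, Z and R depend only on j, so each entry becomes a polynomial in
    b and \<i>.\<close>
  define \<zeta> :: complex where "\<zeta> = (if j \<le> 1 then of_nat q else 0)"
  define \<eta> :: complex where "\<eta> = (if j = 0 then of_nat q * of_nat q else 0)"
  have u: "u a = D_value j" using assms by (simp add: dual_class_def)
  have Z: "char_sum (ch a) Z = \<zeta>"
    using dual_classD(2)[OF assms(3,2)] by (simp add: \<zeta>_def char_sum_Z)
  have U: "char_sum (ch a) UNIV = \<eta>"
    using dual_classD(1)[OF assms(3,2)] by (simp add: \<eta>_def char_sum_UNIV)
  note sums = char_sum_S_class char_sum_Y u Z U
  show ?thesis
  proof (cases "odd n")
    case True
    define b :: complex where "b = 2 ^ ((n - 1) div 2)"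
    have b: "cnj b = b" by (simp add: b_def)
    have q: "of_nat q = 2 * (b * b)"
    proof -
      have "n = Suc ((n - 1) div 2 + (n - 1) div 2)" using True by (elim oddE) simp
      then have "(2::complex) ^ n = 2 ^ Suc ((n - 1) div 2 + (n - 1) div 2)" by (rule arg_cong)
      then show ?thesis by (simp add: b_def power_add)
    qed
    have P: "P_matrix n = P_odd b" using True by (simp add: P_matrix_def b_def)
    have v: "v_value n k = [b + b * \<i>, b - b * \<i>, - b + b * \<i>, - b - b * \<i>] ! (k - 2)" for k
      using True by (simp add: v_value_def b_def Let_def)
    show ?thesis
      unfolding P using assms(1,2) True unfolding atMost_5
      by (elim insertE emptyE; simp only: sums if_False if_True;
          simp add: sums D_value_def \<zeta>_def \<eta>_def v b q[simplified] P_odd_def field_simps eval_nat_numeral)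
  next
    case False
    define b :: complex where "b = 2 ^ ((n - 2) div 2)"
    have b: "cnj b = b" by (simp add: b_def)
    obtain m where m: "n = 2 * Suc m" using False n_pos by (metis evenE gr0_implies_Suc mult_is_0 not_gr0)
    have "(2::complex) ^ n = 2 ^ Suc m * 2 ^ Suc m" by (simp only: m power_add[symmetric] mult_2[symmetric])
    then have q: "of_nat q = 4 * (b * b)" by (simp add: b_def m)
    have P: "P_matrix n = P_even b" using False by (simp add: P_matrix_def b_def)
    \<comment> \<open>For even n the number 2^(n/2) in the values v_j is 2 b.\<close>
    have v: "v_value n k = [2 * b, - (2 * b), 2 * b * \<i>, - (2 * b) * \<i>] ! (k - 2)" for k
      using False by (simp add: v_value_def b_def Let_def m)
    show ?thesis
      unfolding P using assms(1,2) False unfolding atMost_5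
      by (elim insertE emptyE; simp only: sums if_False if_True;
          simp add: sums D_value_def \<zeta>_def \<eta>_def v b q[simplified] P_even_def field_simps eval_nat_numeral)
  qed
qed

lemma P_matrix_Q_matrix:
  assumes "j \<in> {0..5}" "k \<in> {0..5}"
  shows "(\<Sum>i\<in>{0..5}. P_matrix n j i * Q_matrix n i k) = of_bool (j = k) * of_nat CARD('r)"
proof (cases "odd n")
  case True
  then obtain m where m: "n = 2 * m + 1" by (rule oddE)
  have "1 - 2 ^ m * \<i> \<noteq> 0"
  proof
    assume "1 - 2 ^ m * \<i> = 0"
    then have "Re (1 - complex_of_real (2 ^ m) * \<i>) = 0" by simp
    then show False unfolding Re_complex_of_real minus_complex.sel by (simp del: of_real_power)
  qed
  then show ?thesis
    using P_odd_Q_odd[OF assms, of "2 ^ m"] card_ring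
    by (simp add: P_matrix_def Q_matrix_def m power_add power_mult power_mult_distrib power_even_eq ac_simps power4_eq_xxxx)
next
  case False
  then obtain m where m: "n = 2 * Suc m" using n_pos by (metis evenE gr0_implies_Suc mult_is_0 not_gr0)
  then show ?thesis
    using P_even_Q_even[OF assms, of "2 ^ m"] card_ring
    by (simp add: P_matrix_def Q_matrix_def m power_add power_mult power_mult_distrib power_even_eq ac_simps power4_eq_xxxx)
qed

sublocale character_table ch "{0..5}" S dual_class "P_matrix n" "Q_matrix n"
  by unfold_locales
     (simp_all add: S_class_eq dual_class_zero S_disjoint_family S_Union dual_class_disjoint
       dual_class_Union uminus_S char_table P_matrix_Q_matrix)

lemma E_class_eq:
  assumes "j \<in> {0..5}" shows "E_class n \<xi> f j = ch ` dual_class j"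
proof -
  have "u a - 1 = z - 1 \<longleftrightarrow> u a = z" for a z by simp
  then show ?thesis
    using assms char_sum_S_class(2)
    by (auto simp: E_class_def gr_chars_def dual_class_zero) (auto simp: dual_class_def D_value_def)
qed

end

theorem theorem4p4:
  fixes \<xi> :: "'r::{finite,comm_ring_1}" and f :: "'r \<Rightarrow> 'r" and n :: nat
  assumes "galois_ring_4 TYPE('r) n"
    and "teich_generator n \<xi>"
    and "pseudo_planar n \<xi> f"
    and "f 0 = 0"
  shows "schur_ring (nonempty_classes (S_class n \<xi> f)) (S_class n \<xi> f)
    \<and> schur_dual (nonempty_classes (S_class n \<xi> f)) (S_class n \<xi> f)
        (nonempty_classes (E_class n \<xi> f)) (E_class n \<xi> f)
    \<and> (n \<ge> 3 \<longrightarrow>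
        association_scheme {0..5} (\<lambda>i. cayley_relation (S_class n \<xi> f i))
      \<and> (\<exists>E. orthogonal_idempotent_basis {0..5} (\<lambda>i. cayley_relation (S_class n \<xi> f i)) E
           \<and> (\<forall>j\<in>{0..5}. E_class n \<xi> f j \<noteq> {} \<and>
                (\<forall>\<psi>\<in>E_class n \<xi> f j. \<forall>i\<in>{0..5}.
                   char_sum \<psi> (S_class n \<xi> f i) = P_matrix n j i))
           \<and> first_eigenmatrix {0..5} (\<lambda>i. cayley_relation (S_class n \<xi> f i)) E (P_matrix n)
           \<and> second_eigenmatrix {0..5} (\<lambda>i. cayley_relation (S_class n \<xi> f i)) E (Q_matrix n)))"
proof -
  interpret planar_function n \<xi> f
    using assms by unfold_locales
  show ?thesis
  proof (intro conjI impI exI ballI)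
    have classes_eq: "nonempty_classes S = classes" by (simp add: nonempty_classes_def)
    have dual_eq: "nonempty_classes (E_class n \<xi> f) = {j \<in> {0..5}. dual_class j \<noteq> {}}"
      by (auto simp: nonempty_classes_def E_class_eq)
    show "schur_ring (nonempty_classes S) S"
      unfolding classes_eq by (rule schur_ring_classes)
    show "schur_dual (nonempty_classes S) S (nonempty_classes (E_class n \<xi> f)) (E_class n \<xi> f)"
    proof -
      have "bij_betw (E_class n \<xi> f) {j \<in> {0..5}. dual_class j \<noteq> {}} (char_group // dual_equiv classes S)
        \<longleftrightarrow> bij_betw (\<lambda>j. ch ` dual_class j) {j \<in> {0..5}. dual_class j \<noteq> {}} (char_group // dual_equiv classes S)"
        by (rule bij_betw_cong) (simp add: E_class_eq)
      then show ?thesis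
        using schur_dual_classes unfolding classes_eq dual_eq schur_dual_def
        by (simp add: E_class_eq)
    qed
    assume n: "n \<ge> 3"
    \<comment> \<open>For n \<ge> 3 row 0 of P and of Q has no zero entry, so no class on either
      side is empty and all six indices remain.\<close>
    have "S i \<noteq> {}" if "i \<in> {0..5}" for i
      using that n by (intro S_nonempty) (simp_all add: eigenmatrix_row_0)
    then have "classes = {0..5}" by blast
    then show "association_scheme {0..5} (\<lambda>i. cayley_relation (S i))"
      using association_scheme_classes by simp
    have T: "dual_class j \<noteq> {}" if "j \<in> {0..5}" for j
      using that n by (intro T_nonempty) (simp_all add: eigenmatrix_row_0)
    then show "orthogonal_idempotent_basis {0..5} (\<lambda>i. cayley_relation (S i)) (\<lambda>k. cayley_matrix (idem k))"
      by (rule orthogonal_idempotent_basis_idem)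
    show "E_class n \<xi> f j \<noteq> {}" if "j \<in> {0..5}" for j
      using T that by (simp add: E_class_eq)
    show "char_sum \<psi> (S i) = P_matrix n j i" if "j \<in> {0..5}" "\<psi> \<in> E_class n \<xi> f j" "i \<in> {0..5}" for \<psi> i j
      using that by (auto simp: E_class_eq char_table)
    show "first_eigenmatrix {0..5} (\<lambda>i. cayley_relation (S i)) (\<lambda>k. cayley_matrix (idem k)) (P_matrix n)"
      by (rule first_eigenmatrix_idem)
    show "second_eigenmatrix {0..5} (\<lambda>i. cayley_relation (S i)) (\<lambda>k. cayley_matrix (idem k)) (Q_matrix n)"
      by (rule second_eigenmatrix_idem)
  qed
qed

end
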